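(* For $p>0$ and $0<r<1$ let $\varphi_p(z)=\left(1-\frac{|z|^2}{r^2}\right)_+^{p/2}$, $z\in\mathbb D$. For fixed $L>0$ (and fixed $p$), as $r\to1^-$: 1. if $p<1$, then $\mathbb V[\mathcal X_L(\varphi_p)]=\Theta\big((1-r)^{-(1-p)}\big)$; 2. if $p=1$, then $\mathbb V[\mathcal X_L(\varphi_p)]=\Theta(-\log(1-r))$; 3. if $p>1$, then $\mathbb V[\mathcal X_L(\varphi_p)]=\Theta(1)$.
   Context: $\mathbb D$ is the open unit disk, $m$ is Lebesgue measure, $x_+=\max(x,0)$. For $L>0$, $\mathcal X_L$ is the determinantal point process in $\mathbb D$ with kernel $\mathbb K_L(z,w)=\frac1{(1-z\bar w)^{L+1}}$ with respect to the measure $d\mu_L(z)=\frac L\pi(1-|z|^2)^{L-1}dm(z)$ on $\mathbb D$; that is, a simple point process whose joint intensities (correlation functions) with respect to $\mu_L$ are $\rho_k(x_1,\dots,x_k)=\det(\mathbb K_L(x_i,x_j))_{1\le i,j\le k}$, $k\ge1$. For a compactly supported function $\varphi$ on $\mathbb D$ the linear statistic is $\mathcal X_L(\varphi)=\sum_{z\in\mathcal X_L}\varphi(z)$. $\mathbb V[X]$ is the variance of $X$. $f(r)=\Theta(h(r))$ as $r\to1^-$ means that $f/h$ is bounded above and below by positive constants (which may depend on $L$ and $p$) for $r$ close to $1$. *)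

theory Defs
  imports "HOL-Probability.Probability" "Jordan_Normal_Form.Determinant"
begin

(* A simple point process in D is encoded by its random, locally finite set of points. *)
definition simple_point_process :: "'a measure \<Rightarrow> complex set \<Rightarrow> ('a \<Rightarrow> complex set) \<Rightarrow> bool" where
  "simple_point_process M D X \<longleftrightarrow>
     prob_space M \<and>
     (\<forall>\<omega>\<in>space M. X \<omega> \<subseteq> D \<and> (\<forall>C. compact C \<and> C \<subseteq> D \<longrightarrow> finite (X \<omega> \<inter> C))) \<and>
     (\<forall>B\<in>sets borel. B \<subseteq> D \<longrightarrow>
        (\<lambda>\<omega>. emeasure (count_space UNIV) (X \<omega> \<inter> B)) \<in> borel_measurable M)"

(* rho k x is the k-point intensity at (x 0, ..., x (k - 1)).  Only its values at points of
   D are constrained.  A possibly infinite number of points in B i is counted in ennreal. *)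
definition has_joint_intensities ::
  "'a measure \<Rightarrow> complex set \<Rightarrow> ('a \<Rightarrow> complex set) \<Rightarrow> complex measure \<Rightarrow>
   (nat \<Rightarrow> (nat \<Rightarrow> complex) \<Rightarrow> real) \<Rightarrow> bool" where
  "has_joint_intensities M D X \<mu> \<rho> \<longleftrightarrow>
     (\<forall>k\<ge>1.
        (\<forall>x \<in> {..<k} \<rightarrow>\<^sub>E D. 0 \<le> \<rho> k x \<and> (\<not> inj_on x {..<k} \<longrightarrow> \<rho> k x = 0)) \<and>
        (\<forall>B. (\<forall>i<k. B i \<in> sets borel \<and> B i \<subseteq> D) \<and> disjoint_family_on B {..<k} \<longrightarrow>
           (\<integral>\<^sup>+\<omega>. (\<Prod>i<k. emeasure (count_space UNIV) (X \<omega> \<inter> B i)) \<partial>M) =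
           (\<integral>\<^sup>+x \<in> Pi\<^sub>E {..<k} B. ennreal (\<rho> k x) \<partial>(\<Pi>\<^sub>M i\<in>{..<k}. \<mu>))))"

(* The determinants are complex numbers; the equation forces them to be real on D, which
   they are for Hermitian kernels. *)
definition determinantal_process ::
  "'a measure \<Rightarrow> complex set \<Rightarrow> ('a \<Rightarrow> complex set) \<Rightarrow> complex measure \<Rightarrow>
   (complex \<Rightarrow> complex \<Rightarrow> complex) \<Rightarrow> bool" where
  "determinantal_process M D X \<mu> K \<longleftrightarrow>
     simple_point_process M D X \<and>
     (\<exists>\<rho>. has_joint_intensities M D X \<mu> \<rho> \<and>
          (\<forall>k\<ge>1. \<forall>x \<in> {..<k} \<rightarrow>\<^sub>E D.
             complex_of_real (\<rho> k x) = Determinant.det (Matrix.mat k k (\<lambda>(i, j). K (x i) (x j)))))"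

abbreviation unit_disk :: "complex set" where
  "unit_disk \<equiv> ball 0 1"

(* For z and w in the unit disk, 1 - z * cnj w has positive real part, so the principal
   branch used by powr is the holomorphic branch equal to 1 at z = 0. *)
definition disk_kernel :: "real \<Rightarrow> complex \<Rightarrow> complex \<Rightarrow> complex" where
  "disk_kernel L z w = 1 / (1 - z * cnj w) powr complex_of_real (L + 1)"

definition disk_measure :: "real \<Rightarrow> complex measure" where
  "disk_measure L =
     density lborel (\<lambda>z. ennreal (L / pi * (1 - (cmod z)\<^sup>2) powr (L - 1)) * indicator unit_disk z)"

definition hyperbolic_dpp :: "real \<Rightarrow> 'a measure \<Rightarrow> ('a \<Rightarrow> complex set) \<Rightarrow> bool" where
  "hyperbolic_dpp L M X \<longleftrightarrow>
     determinantal_process M unit_disk X (disk_measure L) (disk_kernel L)"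

(* X \<omega> may be infinite; for compactly supported f the sum has finitely many nonzero terms. *)
definition linear_statistic ::
  "('a \<Rightarrow> complex set) \<Rightarrow> (complex \<Rightarrow> real) \<Rightarrow> 'a \<Rightarrow> real" where
  "linear_statistic X f \<omega> = (\<Sum>\<^sub>\<infinity>z\<in>X \<omega>. f z)"

definition test_fun :: "real \<Rightarrow> real \<Rightarrow> complex \<Rightarrow> real" where
  "test_fun p r z = max (1 - (cmod z)\<^sup>2 / r\<^sup>2) 0 powr (p / 2)"

end

theory Submission
  imports Defs "HOL-Real_Asymp.Real_Asymp"
begin

text \<open>
  Write \<open>k z = (1 - |z|\<^sup>2) powr -(L + 1)\<close> for the one-point intensity with respect to
  \<open>\<mu> = disk_measure L\<close>, \<open>k\<^sub>2 z w = |1 - z * cnj w| powr -2(L + 1)\<close> for the squared modulus of the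
  kernel, and \<open>f = test_fun p r\<close>. The first two joint intensities give
  \<open>Var = \<integral> f\<^sup>2 k d\<mu> - \<integral>\<integral> f(z) f(w) k\<^sub>2(z, w) d\<mu> d\<mu>\<close> (\<open>variance_linear_statistic\<close>).

  Upper bound: dropping the double integral leaves \<open>\<integral> f\<^sup>2 k d\<mu>\<close>. In the variable
  \<open>s = 1 - |z|\<^sup>2\<close> the measure \<open>\<mu>\<close> becomes \<open>L s powr (L - 1) ds\<close>, and \<open>f\<^sup>2 \<le> s powr p\<close> vanishes for
  \<open>s \<le> 1 - r\<^sup>2\<close>; hence \<open>Var \<le> L \<integral> s powr (p - 2) ds\<close> over \<open>1 - r\<^sup>2 \<le> s \<le> 1\<close>
  (\<open>variance_upper_bound\<close>).

  Lower bound: the reproducing identity \<open>\<integral> k\<^sub>2(z, w) d\<mu>(w) = k z\<close> follows from the change of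
  variables \<open>w = (z - u) / (1 - cnj z * u)\<close> (\<open>nn_integral_kernel_sq\<close>), and turns the variance
  formula into \<open>2 Var = \<integral>\<integral> (f z - f w)\<^sup>2 k\<^sub>2(z, w) d\<mu> d\<mu>\<close>
  (\<open>variance_linear_statistic_dirichlet\<close>). For \<open>s\<close> between \<open>2 (1 - r\<^sup>2)\<close> and \<open>1/4\<close>, a Euclidean
  disk of radius \<open>s/2\<close> at distance of order \<open>s\<close> from \<open>z\<close>, on the side of the origin,
  contributes at least a constant times \<open>s powr (p - L - 1)\<close> to the inner integral
  (\<open>local_dirichlet_lower_bound\<close>), and integration in \<open>z\<close> gives again a constant times
  \<open>\<integral> s powr (p - 2) ds\<close>, now over \<open>2 (1 - r\<^sup>2) \<le> s \<le> 1/4\<close>. Both integrals have the asserted order of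
  growth in each of the three ranges of \<open>p\<close>.
\<close>

section \<open>Holomorphic change of variables in the plane\<close>

text \<open>
  The change of variables theorem is about \<open>real^'n\<close>; the coordinate isomorphism between
  \<open>real^2\<close> and the complex plane transports it.
\<close>
definition cplx_of_vec :: "real^2 \<Rightarrow> complex" where
  "cplx_of_vec v = Complex (vec_nth v 1) (vec_nth v 2)"

definition vec_of_cplx :: "complex \<Rightarrow> real^2" where
  "vec_of_cplx z = (\<chi> i. if i = 1 then Re z else Im z)"

lemma cplx_of_vec_of_cplx [simp]: "cplx_of_vec (vec_of_cplx z) = z"
  and vec_of_cplx_of_vec [simp]: "vec_of_cplx (cplx_of_vec v) = v"
  by (auto simp: cplx_of_vec_def vec_of_cplx_def complex_eq_iff Finite_Cartesian_Product.vec_eq_iff forall_2)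

lemma bounded_linear_cplx_of_vec: "bounded_linear cplx_of_vec"
  by (subst linear_conv_bounded_linear[symmetric], rule linearI)
     (auto simp: cplx_of_vec_def complex_eq_iff)

lemma bounded_linear_vec_of_cplx: "bounded_linear vec_of_cplx"
  by (subst linear_conv_bounded_linear[symmetric], rule linearI)
     (auto simp: vec_of_cplx_def Finite_Cartesian_Product.vec_eq_iff)

lemma measurable_cplx_of_vec [measurable]: "cplx_of_vec \<in> borel_measurable borel"
  using bounded_linear_cplx_of_vec
  by (intro borel_measurable_continuous_onI linear_continuous_on)

lemma lborel_cplx_of_vec: "distr lborel borel cplx_of_vec = lborel"
proof (rule lborel_eqI[symmetric])
  fix l u :: complex assume le: "\<And>b. b \<in> Basis \<Longrightarrow> inner l b \<le> inner u b"
  have le': "Re l \<le> Re u" "Im l \<le> Im u"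
    using le[of 1] le[of \<i>] by (auto simp: Basis_complex_def)
  have eq: "cplx_of_vec -` box l u = box (vec_of_cplx l) (vec_of_cplx u)"
    by (auto simp: box_def Basis_complex_def cplx_of_vec_def vec_of_cplx_def Basis_vec_def
        inner_axis UNIV_2)
  have "emeasure (distr lborel borel cplx_of_vec) (box l u) = emeasure lborel (box (vec_of_cplx l) (vec_of_cplx u))"
    by (subst emeasure_distr) (auto simp: eq)
  also have "\<dots> = (\<Prod>b\<in>Basis. inner (vec_of_cplx u - vec_of_cplx l) b)"
    using le' by (intro emeasure_lborel_box)
      (auto simp: vec_of_cplx_def Basis_vec_def inner_axis UNIV_2 )
  also have "(\<Prod>b\<in>Basis. inner (vec_of_cplx u - vec_of_cplx l) b) = (Re u - Re l) * (Im u - Im l)"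
    by (auto simp: vec_of_cplx_def Basis_vec_def inner_axis UNIV_2 axis_eq_axis)
  also have "\<dots> = (\<Prod>b\<in>Basis. inner (u - l) b)"
    by (auto simp: Basis_complex_def)
  finally show "emeasure (distr lborel borel cplx_of_vec) (box l u) = (\<Prod>b\<in>Basis. inner (u - l) b)" .
qed auto

lemma nn_integral_cplx_of_vec:
  assumes "f \<in> borel_measurable borel"
  shows "(\<integral>\<^sup>+z. f z \<partial>lborel) = (\<integral>\<^sup>+v. f (cplx_of_vec v) \<partial>lborel)"
  using assms by (subst lborel_cplx_of_vec[symmetric], subst nn_integral_distr) auto

text \<open>Multiplication by \<open>a\<close>, as a real linear map of the plane, has determinant \<open>|a|\<^sup>2\<close>.\<close>
lemma det_matrix_mult:
  "Determinants.det (matrix (\<lambda>v. vec_of_cplx (a * cplx_of_vec v))) = (cmod a)\<^sup>2"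
  unfolding det_2 matrix_def cmod_power2
  by (simp add: vec_of_cplx_def cplx_of_vec_def axis_def power2_eq_square)

text \<open>
  The value of the transformed integral is assumed to be finite, since the underlying theorem is
  about absolutely integrable functions.
\<close>
lemma nn_integral_substitution_complex:
  fixes g g' :: "complex \<Rightarrow> complex" and h :: "complex \<Rightarrow> real"
  assumes S: "S \<in> sets borel" and T: "g ` S \<in> sets borel"
    and der: "\<And>z. z \<in> S \<Longrightarrow> (g has_field_derivative g' z) (at z)"
    and inj: "inj_on g S"
    and nonneg: "\<And>w. 0 \<le> h w" and h [measurable]: "h \<in> borel_measurable borel"
    and m: "(\<lambda>z. h (g z) * (cmod (g' z))\<^sup>2 * indicator S z) \<in> borel_measurable borel"
    and c: "(\<integral>\<^sup>+z\<in>S. ennreal (h (g z) * (cmod (g' z))\<^sup>2) \<partial>lborel) = ennreal c" "0 \<le> c"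
  shows "(\<integral>\<^sup>+w\<in>g ` S. ennreal (h w) \<partial>lborel) = ennreal c"
proof -
  define S' where "S' = cplx_of_vec -` S"
  define G where "G = (\<lambda>v. vec_of_cplx (g (cplx_of_vec v)))"
  define G' where "G' = (\<lambda>x v. vec_of_cplx (g' (cplx_of_vec x) * cplx_of_vec v))"
  define D where "D = (\<lambda>x. (cmod (g' (cplx_of_vec x)))\<^sup>2)"
  have S'b: "S' \<in> sets borel"
    unfolding S'_def using measurable_sets[OF measurable_cplx_of_vec S] by simp
  have GS: "G ` S' = cplx_of_vec -` (g ` S)"
    unfolding G_def S'_def
  proof safe
    fix v w assume "cplx_of_vec v = g w" "w \<in> S"
    then show "v \<in> (\<lambda>v. vec_of_cplx (g (cplx_of_vec v))) ` (cplx_of_vec -` S)"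
      by (intro image_eqI[of _ _ "vec_of_cplx w"]) (auto, metis vec_of_cplx_of_vec)
  qed auto
  have GSb: "G ` S' \<in> sets borel"
    unfolding GS using measurable_sets[OF measurable_cplx_of_vec T] by simp
  have der': "(G has_derivative G' x) (at x within S')" if "x \<in> S'" for x
  proof -
    have "(g has_derivative (*) (g' (cplx_of_vec x))) (at (cplx_of_vec x))"
      using der[of "cplx_of_vec x"] that by (simp add: S'_def has_field_derivative_def)
    then show ?thesis
      unfolding G_def G'_def
      by (intro bounded_linear.has_derivative[OF bounded_linear_vec_of_cplx]
          has_derivative_compose[where f = cplx_of_vec and g = g]
          bounded_linear_imp_has_derivative[OF bounded_linear_cplx_of_vec])
  qed
  have inj': "inj_on G S'"
    using inj unfolding inj_on_def G_def S'_def
    by (metis cplx_of_vec_of_cplx vec_of_cplx_of_vec vimageE)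
  have iff: "((\<lambda>x. D x * h (cplx_of_vec (G x))) absolutely_integrable_on S' \<and>
         integral S' (\<lambda>x. D x * h (cplx_of_vec (G x))) = c) \<longleftrightarrow>
        ((\<lambda>x. h (cplx_of_vec x)) absolutely_integrable_on G ` S' \<and>
         integral (G ` S') (\<lambda>x. h (cplx_of_vec x)) = c)"
    using has_absolute_integral_change_of_variables[OF _ der' inj',
        of "\<lambda>x. Finite_Cartesian_Product.vec (h (cplx_of_vec x)) :: real^1" "Finite_Cartesian_Product.vec c"] S'b
    unfolding absolutely_integrable_on_1_iff integral_on_1_eq integrable_on_1_iff
    by (auto simp: G'_def det_matrix_mult D_def)
  have "((\<lambda>x. D x * h (cplx_of_vec (G x)) * indicator S' x) has_integral c) UNIV"
  proof (rule nn_integral_has_integral)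
    have "(\<lambda>v. (\<lambda>z. h (g z) * (cmod (g' z))\<^sup>2 * indicator S z) (cplx_of_vec v)) \<in> borel_measurable borel"
      by (rule measurable_compose[OF measurable_cplx_of_vec m])
    also have "(\<lambda>v. (\<lambda>z. h (g z) * (cmod (g' z))\<^sup>2 * indicator S z) (cplx_of_vec v)) =
       (\<lambda>x. D x * h (cplx_of_vec (G x)) * indicator S' x)"
      by (auto simp: D_def G_def S'_def fun_eq_iff indicator_def)
    finally show "(\<lambda>x. D x * h (cplx_of_vec (G x)) * indicator S' x) \<in> borel_measurable borel" .
    have "ennreal c = (\<integral>\<^sup>+z. ennreal (h (g z) * (cmod (g' z))\<^sup>2 * indicator S z) \<partial>lborel)"
      unfolding c(1)[symmetric] by (intro nn_integral_cong) (auto simp: indicator_def)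
    also have "\<dots> = (\<integral>\<^sup>+x. ennreal (D x * h (cplx_of_vec (G x)) * indicator S' x) \<partial>lborel)"
      using m by (subst nn_integral_cplx_of_vec)
        (auto intro!: nn_integral_cong simp: D_def G_def S'_def indicator_def mult.commute)
    finally show "(\<integral>\<^sup>+x. ennreal (D x * h (cplx_of_vec (G x)) * indicator S' x) \<partial>lborel) = ennreal c" ..
  qed (use nonneg c(2) in \<open>auto simp: D_def\<close>)
  also have "(\<lambda>x. D x * h (cplx_of_vec (G x)) * indicator S' x) =
      (\<lambda>x. if x \<in> S' then D x * h (cplx_of_vec (G x)) else 0)"
    by auto
  finally have hi: "((\<lambda>x. D x * h (cplx_of_vec (G x))) has_integral c) S'"
    by (simp only: has_integral_restrict_UNIV)
  then have "(\<lambda>x. D x * h (cplx_of_vec (G x))) absolutely_integrable_on S'"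
    using nonneg by (subst absolutely_integrable_on_iff_nonneg) (auto simp: D_def has_integral_iff)
  with hi iff have *: "((\<lambda>x. h (cplx_of_vec x)) absolutely_integrable_on G ` S' \<and>
         integral (G ` S') (\<lambda>x. h (cplx_of_vec x)) = c)"
    by (auto simp: has_integral_iff)
  then have "((\<lambda>x. h (cplx_of_vec x)) has_integral c) (G ` S')"
    by (auto simp: has_integral_iff absolutely_integrable_on_def)
  then have "(\<integral>\<^sup>+x. ennreal (indicator (G ` S') x * h (cplx_of_vec x)) \<partial>lborel) = ennreal c"
    by (intro nn_integral_has_integral_lebesgue) (use nonneg in auto)
  also have "(\<integral>\<^sup>+x. ennreal (indicator (G ` S') x * h (cplx_of_vec x)) \<partial>lborel) =
     (\<integral>\<^sup>+w\<in>g ` S. ennreal (h w) \<partial>lborel)"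
    using T by (subst nn_integral_cplx_of_vec)
      (auto intro!: nn_integral_cong simp: GS indicator_def)
  finally show ?thesis .
qed

section \<open>Radial integrals and the reproducing property on the disk\<close>

lemma sets_borel_unit_disk [measurable, simp]: "unit_disk \<in> sets borel"
  by (rule borel_open) simp

lemma borel_measurable_cnj [measurable]: "cnj \<in> borel_measurable borel"
  by (rule borel_measurable_continuous_onI) (auto intro: continuous_intros)

text \<open>
  The area of an annulus determines the image of Lebesgue
  measure on the disk under \<open>|z|\<^sup>2 - 1\<close>, which is \<open>pi\<close> times Lebesgue measure on \<open>[-1, 0)\<close>.
\<close>
lemma nn_integral_unit_disk_radial:
  assumes [measurable]: "f \<in> borel_measurable borel"
  shows "(\<integral>\<^sup>+z\<in>unit_disk. f (1 - (cmod z)\<^sup>2) \<partial>lborel) = ennreal pi * (\<integral>\<^sup>+s\<in>{0<..1}. f s \<partial>lborel)"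
proof -
  let ?M = "distr (density lborel (indicator unit_disk)) borel (\<lambda>z::complex. - (1 - (cmod z)\<^sup>2))"
  let ?N = "density lborel (\<lambda>t::real. ennreal pi * indicator {-1..<0} t)"
  have M: "emeasure ?M {x<..} = ennreal (pi * (- max (-1) (min x 0)))" for x
  proof -
    have "emeasure ?M {x<..} = emeasure lborel {z::complex. cmod z < 1 \<and> x < - (1 - (cmod z)\<^sup>2)}"
      by (subst emeasure_distr, simp, simp, subst emeasure_density)
        (measurable, auto simp: nn_integral_indicator[symmetric] indicator_def
          simp del: nn_integral_indicator intro!: nn_integral_cong)
    also have "\<dots> = ennreal (pi * (- max (-1) (min x 0)))"
    proof (cases "x < -1")
      case True
      then have eq: "{z::complex. cmod z < 1 \<and> x < - (1 - (cmod z)\<^sup>2)} = ball 0 1"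
        by (auto simp: algebra_simps intro: less_le_trans[OF _ zero_le_power2])
      show ?thesis using True unfolding eq by (subst emeasure_ball) (auto simp: eval_unit_ball_vol)
    next
      case False
      show ?thesis
      proof (cases "x < 0")
        case True
        have *: "x < - (1 - (cmod z)\<^sup>2) \<longleftrightarrow> sqrt (1 + x) < cmod z" for z
          using False by (metis add.commute add_uminus_conv_diff less_diff_eq minus_diff_eq norm_ge_zero not_le real_sqrt_less_iff real_sqrt_unique)
        have eq: "{z::complex. cmod z < 1 \<and> x < - (1 - (cmod z)\<^sup>2)} = ball 0 1 - cball 0 (sqrt (1 + x))"
          unfolding * by auto
        have "emeasure lborel (ball 0 1 - cball 0 (sqrt (1 + x)) :: complex set) =
            emeasure lborel (ball 0 1 :: complex set) - emeasure lborel (cball 0 (sqrt (1 + x)) :: complex set)"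
          using True False
          by (intro emeasure_Diff) (auto simp: emeasure_cball subset_iff intro: le_less_trans)
        also have "\<dots> = ennreal pi - ennreal (pi * (1 + x))"
          using True False by (subst emeasure_ball, simp, subst emeasure_cball) (auto simp: eval_unit_ball_vol)
        also have "\<dots> = ennreal (pi * (- x))"
        proof -
          have "0 \<le> pi * (1 + x)" using False by (intro mult_nonneg_nonneg) auto
          then show ?thesis by (simp only: ennreal_minus) (simp add: algebra_simps)
        qed
        finally show ?thesis using True False unfolding eq by simp
      next
        case F: False
        have "(cmod z)\<^sup>2 < 1" if "cmod z < 1" for z :: complex
          using that abs_square_less_1[of "cmod z"] by simp
        with F have eq: "{z::complex. cmod z < 1 \<and> x < - (1 - (cmod z)\<^sup>2)} = {}"
            by fastforce
        show ?thesis unfolding eq using F by simp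
      qed
    qed
    finally show ?thesis .
  qed
  have N: "emeasure ?N {x<..} = ennreal (pi * (- max (-1) (min x 0)))" for x
  proof -
    have "emeasure ?N {x<..} = (\<integral>\<^sup>+t. ennreal pi * indicator ({x<..} \<inter> {-1..<0}) t \<partial>lborel)"
      by (subst emeasure_density) (auto intro!: nn_integral_cong simp: indicator_def)
    also have "\<dots> = ennreal pi * emeasure lborel ({x<..} \<inter> {-1..<0})"
      by (subst nn_integral_cmult) auto
    also have "{x<..} \<inter> {-1..<0} = (if x < -1 then {-1..<0} else if x < 0 then {x<..<0} else {})"
      by auto
    also have "ennreal pi * emeasure lborel \<dots> = ennreal (pi * (- max (-1) (min x 0)))"
      by (auto simp: ennreal_mult[symmetric] ennreal_mult'[symmetric] simp flip: ennreal_minus)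
    finally show ?thesis .
  qed
  \<comment> \<open>It suffices to compare on half-lines \<open>{x<..}\<close>, whose preimages are annuli.\<close>
  have MN: "?M = ?N"
  proof (rule measure_eqI_lessThan)
    show "emeasure ?M {x<..} < \<infinity>" for x
      unfolding M by (rule ennreal_less_top[folded infinity_ennreal_def])
    show "emeasure ?M {x<..} = emeasure ?N {x<..}" for x
      unfolding M N ..
  qed auto
  have "(\<integral>\<^sup>+z\<in>unit_disk. f (1 - (cmod z)\<^sup>2) \<partial>lborel) = (\<integral>\<^sup>+t. f (- t) \<partial>?M)"
    by (subst nn_integral_distr, simp, simp, subst nn_integral_density)
      (auto intro!: nn_integral_cong simp: mult.commute)
  also have "\<dots> = (\<integral>\<^sup>+t. ennreal pi * (f (- t) * indicator {0<..1} (- t)) \<partial>lborel)"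
    unfolding MN by (subst nn_integral_density)
      (auto intro!: nn_integral_cong simp: indicator_def)
  also have "\<dots> = ennreal pi * (\<integral>\<^sup>+t. (f (- t) * indicator {0<..1} (- t)) \<partial>lborel)"
    by (subst nn_integral_cmult) auto
  also have "(\<integral>\<^sup>+t. (f (- t) * indicator {0<..1} (- t)) \<partial>lborel) = (\<integral>\<^sup>+s\<in>{0<..1}. f s \<partial>lborel)"
    using nn_integral_real_affine[of "\<lambda>s. f s * indicator {0<..1} s" "-1" 0] by simp
  finally show ?thesis .
qed

lemma sets_disk_measure [measurable_cong, simp]: "sets (disk_measure L) = sets borel"
  and space_disk_measure [simp]: "space (disk_measure L) = UNIV"
  by (auto simp: disk_measure_def)

lemma nn_integral_disk_measure:
  assumes [measurable]: "f \<in> borel_measurable borel"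
  shows "(\<integral>\<^sup>+z. f z \<partial>disk_measure L) =
    (\<integral>\<^sup>+z\<in>unit_disk. (ennreal (L / pi * (1 - (cmod z)\<^sup>2) powr (L - 1)) * f z) \<partial>lborel)"
proof -
  have "(\<lambda>z. ennreal (L / pi * (1 - (cmod z)\<^sup>2) powr (L - 1)) * indicator unit_disk z) \<in> borel_measurable lborel"
    by measurable
  then show ?thesis
    unfolding disk_measure_def
    by (subst nn_integral_density) (auto intro!: nn_integral_cong simp: ac_simps)
qed

lemma nn_integral_disk_measure_radial:
  assumes [measurable]: "f \<in> borel_measurable borel" and "0 < L"
  shows "(\<integral>\<^sup>+z. f (1 - (cmod z)\<^sup>2) \<partial>disk_measure L) =
    (\<integral>\<^sup>+s\<in>{0<..1}. (ennreal (L * s powr (L - 1)) * f s) \<partial>lborel)"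
proof -
  have "(\<integral>\<^sup>+z. f (1 - (cmod z)\<^sup>2) \<partial>disk_measure L) =
    ennreal pi * (\<integral>\<^sup>+s\<in>{0<..1}. (ennreal (L / pi * s powr (L - 1)) * f s) \<partial>lborel)"
    by (subst nn_integral_disk_measure) (simp_all flip: nn_integral_unit_disk_radial)
  also have "\<dots> = (\<integral>\<^sup>+s\<in>{0<..1}. (ennreal (L * s powr (L - 1)) * f s) \<partial>lborel)"
    using \<open>0 < L\<close>
    by (subst nn_integral_cmult[symmetric])
      (auto intro!: nn_integral_cong simp: ennreal_mult'[symmetric] simp flip: mult.assoc)
  finally show ?thesis .
qed

lemma emeasure_disk_measure_UNIV:
  assumes "0 < L" shows "emeasure (disk_measure L) UNIV = 1"
proof -
  have "emeasure (disk_measure L) UNIV = (\<integral>\<^sup>+z. 1 \<partial>disk_measure L)"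
    by simp
  also have "\<dots> = (\<integral>\<^sup>+s\<in>{0<..1}. (ennreal (L * s powr (L - 1)) * 1) \<partial>lborel)"
    using assms by (subst nn_integral_disk_measure_radial[symmetric]) auto
  also have "\<dots> = (\<integral>\<^sup>+s\<in>{0..1}. ennreal (L * s powr (L - 1)) \<partial>lborel)"
    by (intro nn_integral_cong) (auto simp: indicator_def)
  also have "\<dots> = ennreal 1"
  proof (rule nn_integral_has_integral_lebesgue')
    show "((\<lambda>s. L * s powr (L - 1)) has_integral 1) {0..1}"
      using has_integral_mult_right[OF has_integral_powr_from_0[of "L - 1" 1], of L] assms by simp
  qed (use assms in auto)
  finally show ?thesis by simp
qed

lemma prob_space_disk_measure: "0 < L \<Longrightarrow> prob_space (disk_measure L)"
  by (rule prob_spaceI) (simp add: emeasure_disk_measure_UNIV)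

text \<open>This identity gives both the behaviour of \<open>1 - |z|\<^sup>2\<close> under disk automorphisms and the
  Cauchy-Schwarz inequality \<open>disk_kernel_sq_le\<close> for the kernel.\<close>
lemma cmod_one_minus_mult_cnj_sq:
  "(cmod (1 - cnj a * u))\<^sup>2 - (cmod (a - u))\<^sup>2 = (1 - (cmod a)\<^sup>2) * (1 - (cmod u)\<^sup>2)"
  unfolding cmod_power2 by (simp add: power2_eq_square algebra_simps)

lemma one_minus_mult_cnj_nz:
  assumes "cmod a < 1" "cmod u < 1" shows "1 - cnj a * u \<noteq> 0"
proof
  assume "1 - cnj a * u = 0"
  then have "cmod (cnj a * u) = 1" by (metis norm_one right_minus_eq)
  moreover have "cmod a * cmod u < 1 * 1"
    using assms by (intro mult_strict_mono) auto
  ultimately show False by (simp add: norm_mult)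
qed

text \<open>The automorphism of the unit disk that exchanges \<open>0\<close> and \<open>a\<close>; it is its own inverse.\<close>
definition disk_involution :: "complex \<Rightarrow> complex \<Rightarrow> complex" where
  "disk_involution a u = (a - u) / (1 - cnj a * u)"

lemma disk_involution_facts:
  assumes "cmod a < 1" "cmod u < 1"
  shows one_minus_cmod_disk_involution:
      "1 - (cmod (disk_involution a u))\<^sup>2 = (1 - (cmod a)\<^sup>2) * (1 - (cmod u)\<^sup>2) / (cmod (1 - cnj a * u))\<^sup>2"
    and disk_involution_in_disk: "cmod (disk_involution a u) < 1"
    and disk_involution_involutive: "disk_involution a (disk_involution a u) = u"
    and cmod_one_minus_disk_involution:
      "cmod (1 - a * cnj (disk_involution a u)) = (1 - (cmod a)\<^sup>2) / cmod (1 - cnj a * u)"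
    and disk_involution_deriv:
      "(disk_involution a has_field_derivative (-(1 - (cmod a)\<^sup>2) / (1 - cnj a * u)\<^sup>2)) (at u)"
proof -
  note nz = one_minus_mult_cnj_nz[OF assms]
  have a2: "complex_of_real ((cmod a)\<^sup>2) = a * cnj a"
    using complex_norm_square[of a] by simp
  have pos: "0 < 1 - (cmod a)\<^sup>2" "0 < 1 - (cmod u)\<^sup>2"
    using assms by (auto simp: abs_square_less_1)
  have nza: "1 - a * cnj a \<noteq> 0"
    using pos(1) a2 by (metis diff_gt_0_iff_gt less_irrefl of_real_1 of_real_eq_iff right_minus_eq)
  show 1: "1 - (cmod (disk_involution a u))\<^sup>2 = (1 - (cmod a)\<^sup>2) * (1 - (cmod u)\<^sup>2) / (cmod (1 - cnj a * u))\<^sup>2"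
    unfolding cmod_one_minus_mult_cnj_sq[symmetric] disk_involution_def
    using nz by (simp add: norm_divide power_divide field_simps)
  have "0 < 1 - (cmod (disk_involution a u))\<^sup>2"
    unfolding 1 using pos nz by auto
  then show "cmod (disk_involution a u) < 1"
    using abs_square_less_1[of "cmod (disk_involution a u)"] by simp
  have e1: "1 - cnj a * disk_involution a u = (1 - a * cnj a) / (1 - cnj a * u)"
    using nz by (simp add: disk_involution_def field_simps)
  have e2: "a - disk_involution a u = u * (1 - a * cnj a) / (1 - cnj a * u)"
    using nz by (simp add: disk_involution_def field_simps)
  show "disk_involution a (disk_involution a u) = u"
    unfolding disk_involution_def[of a "disk_involution a u"] e1 e2 using nz nza by simp
  have "cmod (1 - a * cnj (disk_involution a u)) = cmod (1 - cnj a * disk_involution a u)"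
    by (metis complex_cnj_cnj complex_cnj_diff complex_cnj_mult complex_cnj_one complex_mod_cnj)
  also have "\<dots> = cmod (complex_of_real (1 - (cmod a)\<^sup>2)) / cmod (1 - cnj a * u)"
    unfolding e1 norm_divide by (simp add: a2[symmetric])
  also have "cmod (complex_of_real (1 - (cmod a)\<^sup>2)) = 1 - (cmod a)\<^sup>2"
    using pos by (simp only: norm_of_real)
  finally show "cmod (1 - a * cnj (disk_involution a u)) = (1 - (cmod a)\<^sup>2) / cmod (1 - cnj a * u)" .
  show "(disk_involution a has_field_derivative (-(1 - (cmod a)\<^sup>2) / (1 - cnj a * u)\<^sup>2)) (at u)"
    unfolding disk_involution_def[abs_def]
  proof (rule DERIV_cong[OF DERIV_divide])
    show "((\<lambda>u. a - u) has_field_derivative -1) (at u)" "((\<lambda>u. 1 - cnj a * u) has_field_derivative - cnj a) (at u)"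
      by (auto intro!: derivative_eq_intros)
    show "(- 1 * (1 - cnj a * u) - (a - u) * - cnj a) / ((1 - cnj a * u) * (1 - cnj a * u)) =
        (-(1 - (cmod a)\<^sup>2) / (1 - cnj a * u)\<^sup>2)"
      using a2 by (simp add: power2_eq_square algebra_simps)
  qed (rule nz)
qed

text \<open>
  With \<open>A = 1 - |a|\<^sup>2\<close>, \<open>U = 1 - |u|\<^sup>2\<close> and \<open>M = |1 - cnj a * u|\<close>, the left-hand side collects the
  squared kernel, the density of \<open>disk_measure\<close> and the Jacobian after the substitution
  \<open>w = disk_involution a u\<close>. All powers of \<open>M\<close> cancel.
\<close>
lemma powr_change_of_variables:
  assumes "A > 0" "U > 0" "M > (0::real)"
  shows "(A / M) powr (-2 * (L + 1)) * (A * U / M\<^sup>2) powr (L - 1) * (A / M\<^sup>2)\<^sup>2 =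
    A powr (-(L + 1)) * U powr (L - 1)"
proof -
  have "(A / M\<^sup>2)\<^sup>2 = exp (ln ((A / M\<^sup>2)\<^sup>2))"
    using assms by simp
  also have "\<dots> = exp (2 * (ln A - 2 * ln M))"
    using assms by (simp add: ln_realpow ln_div del: exp_ln)
  finally have "(A / M\<^sup>2)\<^sup>2 = exp (2 * (ln A - 2 * ln M))" .
  then show ?thesis
    using assms by (simp add: powr_def ln_mult ln_div ln_realpow exp_add[symmetric] algebra_simps
        del: exp_ln)
qed

text \<open>The reproducing property of the kernel, evaluated on the diagonal.\<close>
lemma nn_integral_kernel_sq:
  assumes "0 < L" "cmod a < 1"
  shows "(\<integral>\<^sup>+w. ennreal (cmod (1 - a * cnj w) powr (-2 * (L + 1))) \<partial>disk_measure L) =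
    ennreal ((1 - (cmod a)\<^sup>2) powr (-(L + 1)))"
proof -
  define h where "h w = cmod (1 - a * cnj w) powr (-2 * (L + 1)) * (L / pi * (1 - (cmod w)\<^sup>2) powr (L - 1))" for w
  define g' where "g' u = (-(1 - (cmod a)\<^sup>2) / (1 - cnj a * u)\<^sup>2)" for u
  have A: "0 < 1 - (cmod a)\<^sup>2"
    using assms by (auto simp: abs_square_less_1)
  have g': "(cmod (g' u))\<^sup>2 = ((1 - (cmod a)\<^sup>2) / (cmod (1 - cnj a * u))\<^sup>2)\<^sup>2" for u
  proof -
    have "cmod (-(1 - (cmod a)\<^sup>2)) = 1 - (cmod a)\<^sup>2"
      using A by (simp only: norm_minus_cancel norm_of_real of_real_minus[symmetric])
    then show ?thesis by (simp add: g'_def norm_divide norm_power)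
  qed
  have img: "disk_involution a ` unit_disk = unit_disk"
    using assms by (auto simp: disk_involution_in_disk image_iff)
      (metis disk_involution_in_disk disk_involution_involutive mem_ball_0)
  have inj: "inj_on (disk_involution a) unit_disk"
    using assms by (metis (no_types, lifting) disk_involution_involutive inj_on_inverseI mem_ball_0)
  have hb [measurable]: "h \<in> borel_measurable borel"
    unfolding h_def[abs_def] by measurable
  have hg: "h (disk_involution a u) * (cmod (g' u))\<^sup>2 =
      (1 - (cmod a)\<^sup>2) powr (-(L + 1)) * (L / pi * (1 - (cmod u)\<^sup>2) powr (L - 1))" if "cmod u < 1" for u
  proof -
    have U: "0 < 1 - (cmod u)\<^sup>2" using that by (auto simp: abs_square_less_1)
    have M: "0 < cmod (1 - cnj a * u)" using one_minus_mult_cnj_nz[OF assms(2) that] by simp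
    have "h (disk_involution a u) * (cmod (g' u))\<^sup>2 =
       (L / pi) * (((1 - (cmod a)\<^sup>2) / cmod (1 - cnj a * u)) powr (-2 * (L + 1)) *
        ((1 - (cmod a)\<^sup>2) * (1 - (cmod u)\<^sup>2) / (cmod (1 - cnj a * u))\<^sup>2) powr (L - 1) * ((1 - (cmod a)\<^sup>2) / (cmod (1 - cnj a * u))\<^sup>2)\<^sup>2)"
      unfolding h_def g' one_minus_cmod_disk_involution[OF assms(2) that]
        cmod_one_minus_disk_involution[OF assms(2) that]
      by (simp only: ac_simps)
    then show ?thesis
      unfolding powr_change_of_variables[OF A U M] by (simp only: ac_simps)
  qed
  have "(\<integral>\<^sup>+w\<in>disk_involution a ` unit_disk. ennreal (h w) \<partial>lborel) =
    ennreal ((1 - (cmod a)\<^sup>2) powr (-(L + 1)))"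
  proof (rule nn_integral_substitution_complex[where g' = g'])
    show "(disk_involution a has_field_derivative g' z) (at z)" if "z \<in> unit_disk" for z
      using disk_involution_deriv[OF assms(2)] that unfolding g'_def by simp
    have eq: "(\<lambda>z. h (disk_involution a z) * (cmod (g' z))\<^sup>2 * indicator unit_disk z) =
     (\<lambda>u. (1 - (cmod a)\<^sup>2) powr (-(L + 1)) * (L / pi * (1 - (cmod u)\<^sup>2) powr (L - 1)) * indicator unit_disk u)"
      by (auto simp: fun_eq_iff indicator_def hg)
    show "(\<lambda>z. h (disk_involution a z) * (cmod (g' z))\<^sup>2 * indicator unit_disk z) \<in> borel_measurable borel"
      unfolding eq by measurable
    have "(\<integral>\<^sup>+z\<in>unit_disk. ennreal (h (disk_involution a z) * (cmod (g' z))\<^sup>2) \<partial>lborel) =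
      (\<integral>\<^sup>+z\<in>unit_disk. (ennreal (L / pi * (1 - (cmod z)\<^sup>2) powr (L - 1)) * ennreal ((1 - (cmod a)\<^sup>2) powr (-(L + 1)))) \<partial>lborel)"
      by (intro nn_integral_cong) (use assms in \<open>auto simp: indicator_def hg ennreal_mult[symmetric] mult.commute\<close>)
    also have "\<dots> = (\<integral>\<^sup>+z. ennreal ((1 - (cmod a)\<^sup>2) powr (-(L + 1))) \<partial>disk_measure L)"
      by (subst nn_integral_disk_measure) auto
    also have "\<dots> = ennreal ((1 - (cmod a)\<^sup>2) powr (-(L + 1)))"
      using emeasure_disk_measure_UNIV[OF assms(1)] by simp
    finally show "(\<integral>\<^sup>+z\<in>unit_disk. ennreal (h (disk_involution a z) * (cmod (g' z))\<^sup>2) \<partial>lborel) =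
      ennreal ((1 - (cmod a)\<^sup>2) powr (-(L + 1)))" .
  qed (use assms in \<open>auto simp: img inj h_def\<close>)
  then have "(\<integral>\<^sup>+w\<in>unit_disk. ennreal (h w) \<partial>lborel) = ennreal ((1 - (cmod a)\<^sup>2) powr (-(L + 1)))"
    unfolding img .
  moreover have "(\<integral>\<^sup>+w\<in>unit_disk. ennreal (h w) \<partial>lborel) =
     (\<integral>\<^sup>+w. ennreal (cmod (1 - a * cnj w) powr (-2 * (L + 1))) \<partial>disk_measure L)"
    by (subst nn_integral_disk_measure)
      (use assms in \<open>auto intro!: nn_integral_cong simp: h_def ennreal_mult[symmetric] mult.commute\<close>)
  ultimately show ?thesis by simp
qed

section \<open>First and second moments of sums over a point process\<close>

text \<open>
  The sum of a nonnegative function over an arbitrary set, with values in the extended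
  nonnegative reals. As an integral it inherits the monotone convergence theorem.
\<close>
definition point_sum :: "'b set \<Rightarrow> ('b \<Rightarrow> ennreal) \<Rightarrow> ennreal" where
  "point_sum A f = (\<integral>\<^sup>+z. f z \<partial>count_space A)"

lemma point_sum_indicator:
  "point_sum A (indicator B) = emeasure (count_space UNIV) (A \<inter> B)"
proof -
  have "point_sum A (indicator B) = (\<integral>\<^sup>+z. indicator (A \<inter> B) z \<partial>count_space UNIV)"
    unfolding point_sum_def
    by (subst nn_integral_count_space_indicator, simp, intro nn_integral_cong)
      (auto split: split_indicator)
  then show ?thesis by simp
qed

lemma nn_integral_iterated_SUP:
  fixes G :: "nat \<Rightarrow> 'b \<Rightarrow> 'b \<Rightarrow> ennreal"
  assumes "\<And>n z. z \<in> space N \<Longrightarrow> (\<lambda>w. G n z w) \<in> borel_measurable N"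
    and "\<And>n. (\<lambda>z. \<integral>\<^sup>+w. G n z w \<partial>N) \<in> borel_measurable N"
    and inc: "\<And>z w. incseq (\<lambda>n. G n z w)"
  shows "(\<integral>\<^sup>+z. \<integral>\<^sup>+w. (SUP n. G n z w) \<partial>N \<partial>N) = (SUP n. \<integral>\<^sup>+z. \<integral>\<^sup>+w. G n z w \<partial>N \<partial>N)"
proof -
  have "(\<integral>\<^sup>+z. \<integral>\<^sup>+w. (SUP n. G n z w) \<partial>N \<partial>N) = (\<integral>\<^sup>+z. (SUP n. \<integral>\<^sup>+w. G n z w \<partial>N) \<partial>N)"
    using assms(1) inc
    by (intro nn_integral_cong nn_integral_monotone_convergence_SUP)
      (auto simp: incseq_def le_fun_def)
  also have "\<dots> = (SUP n. \<integral>\<^sup>+z. \<integral>\<^sup>+w. G n z w \<partial>N \<partial>N)"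
    using assms(2) inc
    by (intro nn_integral_monotone_convergence_SUP)
      (auto simp: incseq_def le_fun_def intro!: nn_integral_mono)
  finally show ?thesis .
qed

text \<open>The index of the half-open dyadic square of side \<open>2 ^ -n\<close> that contains \<open>z\<close>.\<close>
definition dyadic_cell :: "nat \<Rightarrow> complex \<Rightarrow> int \<times> int" where
  "dyadic_cell n z = (\<lfloor>2 ^ n * Re z\<rfloor>, \<lfloor>2 ^ n * Im z\<rfloor>)"

lemma sets_dyadic_cell [measurable]: "{z. dyadic_cell n z = i} \<in> sets borel"
proof -
  have "Measurable.pred borel (\<lambda>z. \<lfloor>2 ^ n * Re z\<rfloor> = fst i \<and> \<lfloor>2 ^ n * Im z\<rfloor> = snd i)"
    by measurable
  then show ?thesis
    by (simp add: pred_def dyadic_cell_def prod_eq_iff)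
qed

lemma dyadic_cell_refine:
  assumes "dyadic_cell n z \<noteq> dyadic_cell n w" "n \<le> m"
  shows "dyadic_cell m z \<noteq> dyadic_cell m w"
proof -
  have "\<lfloor>2 ^ n * x\<rfloor> = \<lfloor>2 ^ m * x\<rfloor> div 2 ^ (m - n)" for x :: real
  proof -
    have "2 ^ n * x = 2 ^ m * x / real_of_int (2 ^ (m - n))"
    proof -
      have "(2::real) ^ m = 2 ^ n * 2 ^ (m - n)"
        using \<open>n \<le> m\<close> by (simp flip: power_add)
      then show ?thesis by simp
    qed
    then show ?thesis
      using floor_divide_real_eq_div[of "2 ^ (m - n)" "2 ^ m * x"] by simp
  qed
  with assms(1) show ?thesis
    unfolding dyadic_cell_def by auto
qed

lemma dyadic_cell_separates:
  assumes "z \<noteq> w" shows "\<exists>n. dyadic_cell n z \<noteq> dyadic_cell n w"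
proof -
  have *: "\<exists>n. \<lfloor>2 ^ n * x\<rfloor> \<noteq> \<lfloor>2 ^ n * y\<rfloor>" if "x \<noteq> y" for x y :: real
  proof -
    obtain n where n: "1 / \<bar>x - y\<bar> < 2 ^ n"
      using real_arch_pow[of 2 "1 / \<bar>x - y\<bar>"] by auto
    then have "1 < 2 ^ n * \<bar>x - y\<bar>"
      using that by (simp add: divide_less_eq)
    also have "\<dots> = \<bar>2 ^ n * x - 2 ^ n * y\<bar>"
      unfolding right_diff_distrib[symmetric] by (simp add: abs_mult)
    finally have "1 < \<bar>2 ^ n * x - 2 ^ n * y\<bar>" .
    then have "\<lfloor>2 ^ n * x\<rfloor> \<noteq> \<lfloor>2 ^ n * y\<rfloor>"
      by linarith
    then show ?thesis ..
  qed
  from assms have "Re z \<noteq> Re w \<or> Im z \<noteq> Im w"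
    by (simp add: complex_eq_iff)
  then show ?thesis
    using *[of "Re z" "Re w"] *[of "Im z" "Im w"] by (auto simp: dyadic_cell_def)
qed

text \<open>A finite set of indices that covers the unit disk.\<close>
definition unit_disk_cells :: "nat \<Rightarrow> (int \<times> int) set" where
  "unit_disk_cells n = {- (2 ^ n)..2 ^ n} \<times> {- (2 ^ n)..2 ^ n}"

lemma finite_unit_disk_cells [simp]: "finite (unit_disk_cells n)"
  by (simp add: unit_disk_cells_def)

lemma dyadic_cell_unit_disk:
  assumes "cmod z < 1" shows "dyadic_cell n z \<in> unit_disk_cells n"
proof -
  have *: "- (2 ^ n) \<le> \<lfloor>2 ^ n * x\<rfloor> \<and> \<lfloor>2 ^ n * x\<rfloor> \<le> 2 ^ n" if "\<bar>x\<bar> < 1" for x :: real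
  proof -
    have "\<bar>2 ^ n * x\<bar> \<le> 2 ^ n * 1"
      unfolding abs_mult using that by (intro mult_mono) auto
    then have "- (2 ^ n) \<le> 2 ^ n * x" "2 ^ n * x \<le> 2 ^ n" by linarith+
    then show ?thesis
      unfolding le_floor_iff floor_le_iff of_int_minus of_int_power of_int_numeral by linarith
  qed
  have "\<bar>Re z\<bar> < 1" "\<bar>Im z\<bar> < 1"
    using assms abs_Re_le_cmod[of z] abs_Im_le_cmod[of z] by auto
  then show ?thesis
    using * by (auto simp: dyadic_cell_def unit_disk_cells_def)
qed

text \<open>
  Pairs of points in different cells, written through products of disjoint sets, to which the
  two-point intensity applies.
\<close>
lemma sum_dyadic_cells:
  fixes f :: "complex \<Rightarrow> ennreal"
  assumes "\<And>z. 1 \<le> cmod z \<Longrightarrow> f z = 0"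
  shows "(\<Sum>i\<in>unit_disk_cells n. \<Sum>j\<in>unit_disk_cells n - {i}.
      (f z * indicator {z. dyadic_cell n z = i} z) * (f w * indicator {z. dyadic_cell n z = j} w)) =
    f z * f w * of_bool (dyadic_cell n z \<noteq> dyadic_cell n w)"
proof (cases "cmod z < 1 \<and> cmod w < 1")
  case True
  then have zw: "dyadic_cell n z \<in> unit_disk_cells n" "dyadic_cell n w \<in> unit_disk_cells n"
    by (auto intro: dyadic_cell_unit_disk)
  have "(f z * indicator {z. dyadic_cell n z = i} z) * (f w * indicator {z. dyadic_cell n z = j} w) =
      (if i = dyadic_cell n z then if j = dyadic_cell n w then f z * f w else 0 else 0)" for i j
    by (auto split: split_indicator)
  moreover have "(\<Sum>j\<in>unit_disk_cells n - {i}.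
      if i = dyadic_cell n z then if j = dyadic_cell n w then f z * f w else 0 else 0) =
      (if i = dyadic_cell n z then f z * f w * of_bool (dyadic_cell n z \<noteq> dyadic_cell n w) else 0)" for i
    using zw by (cases "i = dyadic_cell n z") (auto simp: sum.delta)
  ultimately show ?thesis
    using zw by (simp add: sum.delta)
qed (use assms in \<open>auto simp: not_less\<close>)

text \<open>
  A random set whose one-point and two-point intensities with respect to \<open>\<mu>\<close> are \<open>k\<close> and \<open>\<rho>\<close>.
  Test sets range over all Borel subsets of the plane; for a process in a smaller domain, \<open>k\<close>
  and \<open>\<rho>\<close> are extended by zero. The value of \<open>\<rho>\<close> on the diagonal is fixed to be \<open>0\<close>, which
  makes the off-diagonal integrals below equal to the full ones.
\<close>
locale pair_intensity =
  fixes M :: "'a measure" and X :: "'a \<Rightarrow> complex set" and \<mu> :: "complex measure"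
    and k :: "complex \<Rightarrow> ennreal" and \<rho> :: "complex \<Rightarrow> complex \<Rightarrow> ennreal"
  assumes sets_mu [measurable_cong, simp]: "sets \<mu> = sets borel"
    and sigma_finite_mu: "sigma_finite_measure \<mu>"
    and k_measurable [measurable]: "k \<in> borel_measurable borel"
    and \<rho>_measurable [measurable]: "case_prod \<rho> \<in> borel_measurable (borel \<Otimes>\<^sub>M borel)"
    and \<rho>_diagonal: "\<And>z. \<rho> z z = 0"
    and measurable_count: "\<And>B. B \<in> sets borel \<Longrightarrow> (\<lambda>\<omega>. point_sum (X \<omega>) (indicator B)) \<in> borel_measurable M"
    and nn_integral_count: "\<And>B. B \<in> sets borel \<Longrightarrow>
      (\<integral>\<^sup>+\<omega>. point_sum (X \<omega>) (indicator B) \<partial>M) = (\<integral>\<^sup>+z\<in>B. k z \<partial>\<mu>)"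
    and nn_integral_count_pair: "\<And>A B. A \<in> sets borel \<Longrightarrow> B \<in> sets borel \<Longrightarrow> A \<inter> B = {} \<Longrightarrow>
      (\<integral>\<^sup>+\<omega>. point_sum (X \<omega>) (indicator A) * point_sum (X \<omega>) (indicator B) \<partial>M) =
      (\<integral>\<^sup>+z\<in>A. (\<integral>\<^sup>+w\<in>B. \<rho> z w \<partial>\<mu>) \<partial>\<mu>)"
begin

lemma space_mu [simp]: "space \<mu> = UNIV"
  using sets_eq_imp_space_eq[OF sets_mu] by simp

lemma measurable_point_sum [measurable]:
  assumes "f \<in> borel_measurable borel"
  shows "(\<lambda>\<omega>. point_sum (X \<omega>) f) \<in> borel_measurable M"
  using assms
proof (induction rule: borel_measurable_induct)
  case (cong f g)
  then have "f = g" by auto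
  with cong show ?case by simp
next
  case (set A)
  then show ?case by (simp add: measurable_count)
next
  case (mult u c)
  then show ?case by (simp add: point_sum_def nn_integral_cmult)
next
  case (add u v)
  then show ?case by (simp add: point_sum_def nn_integral_add)
next
  case (seq U)
  have "(SUP i. U i) = (\<lambda>z. SUP i. U i z)"
    by (auto simp: fun_eq_iff image_comp)
  then have eq: "point_sum (X \<omega>) (SUP i. U i) = (SUP i. point_sum (X \<omega>) (U i))" for \<omega>
    unfolding point_sum_def using seq.hyps
    by (simp add: nn_integral_monotone_convergence_SUP)
  show ?case unfolding eq using seq.IH by (intro borel_measurable_SUP) auto
qed

text \<open>
  The passage from sets to functions. The weight \<open>W\<close> is \<open>1\<close> for first moments, and it is another
  point sum for mixed second moments, where the passage is made in one factor after the other.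
\<close>
lemma nn_integral_point_sum_weighted:
  assumes [measurable]: "W \<in> borel_measurable M" "\<kappa> \<in> borel_measurable borel" "A \<in> sets borel"
    and *: "\<And>B. B \<in> sets borel \<Longrightarrow> B \<subseteq> A \<Longrightarrow>
      (\<integral>\<^sup>+\<omega>. point_sum (X \<omega>) (indicator B) * W \<omega> \<partial>M) = (\<integral>\<^sup>+z\<in>B. \<kappa> z \<partial>\<mu>)"
    and f: "f \<in> borel_measurable borel"
  shows "(\<integral>\<^sup>+\<omega>. point_sum (X \<omega>) (\<lambda>z. f z * indicator A z) * W \<omega> \<partial>M) = (\<integral>\<^sup>+z. f z * indicator A z * \<kappa> z \<partial>\<mu>)"
proof -
  have ps: "(\<lambda>\<omega>. point_sum (X \<omega>) (\<lambda>z. u z * indicator A z)) \<in> borel_measurable M"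
    if [measurable]: "u \<in> borel_measurable borel" for u
    by (rule measurable_point_sum) measurable
  show ?thesis
    using f
  proof (induction rule: borel_measurable_induct)
    case (cong f g)
    then have "f = g" by auto
    with cong show ?case by simp
  next
    case (set B)
    have "(\<lambda>z. indicator B z * indicator A z :: ennreal) = indicator (B \<inter> A)"
      by (auto simp: indicator_def)
    moreover have "indicator B z * indicator A z = (indicator (B \<inter> A) z :: ennreal)" for z
      by (auto simp: indicator_def)
    ultimately show ?case
      using *[of "B \<inter> A"] set by (simp add: mult.commute)
  next
    case (mult u c)
    note [measurable] = mult(2) ps[OF mult(2)]
    have "(\<integral>\<^sup>+\<omega>. point_sum (X \<omega>) (\<lambda>z. c * u z * indicator A z) * W \<omega> \<partial>M) =
      (\<integral>\<^sup>+\<omega>. c * (point_sum (X \<omega>) (\<lambda>z. u z * indicator A z) * W \<omega>) \<partial>M)"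
      by (simp add: point_sum_def nn_integral_cmult mult.assoc)
    also have "\<dots> = c * (\<integral>\<^sup>+z. u z * indicator A z * \<kappa> z \<partial>\<mu>)"
      by (subst nn_integral_cmult) (simp_all add: mult)
    also have "\<dots> = (\<integral>\<^sup>+z. c * (u z * indicator A z * \<kappa> z) \<partial>\<mu>)"
      by (subst nn_integral_cmult) auto
    finally show ?case by (simp add: mult.assoc)
  next
    case (add u v)
    note [measurable] = add.hyps(1,3) ps[OF add.hyps(1)] ps[OF add.hyps(3)]
    have "(\<integral>\<^sup>+\<omega>. point_sum (X \<omega>) (\<lambda>z. (v z + u z) * indicator A z) * W \<omega> \<partial>M) =
      (\<integral>\<^sup>+\<omega>. point_sum (X \<omega>) (\<lambda>z. v z * indicator A z) * W \<omega> +
          point_sum (X \<omega>) (\<lambda>z. u z * indicator A z) * W \<omega> \<partial>M)"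
      by (simp add: point_sum_def nn_integral_add distrib_right)
    also have "\<dots> = (\<integral>\<^sup>+z. v z * indicator A z * \<kappa> z \<partial>\<mu>) + (\<integral>\<^sup>+z. u z * indicator A z * \<kappa> z \<partial>\<mu>)"
      by (subst nn_integral_add) (simp_all add: add)
    also have "\<dots> = (\<integral>\<^sup>+z. v z * indicator A z * \<kappa> z + u z * indicator A z * \<kappa> z \<partial>\<mu>)"
      by (subst nn_integral_add) auto
    finally show ?case by (simp add: distrib_right)
  next
    case (seq U)
    note [measurable] = seq(1) ps[OF seq(1)]
    have inc: "incseq (\<lambda>i z. U i z * F z)" for F :: "complex \<Rightarrow> ennreal"
      using seq.hyps(3) by (auto simp: incseq_def le_fun_def intro!: mult_right_mono)
    have "point_sum (X \<omega>) (\<lambda>z. (SUP i. U i) z * indicator A z) = (SUP i. point_sum (X \<omega>) (\<lambda>z. U i z * indicator A z))" for \<omega>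
      unfolding point_sum_def using inc
      by (subst nn_integral_monotone_convergence_SUP[symmetric]) (auto simp: SUP_mult_right_ennreal image_comp)
    then have "(\<integral>\<^sup>+\<omega>. point_sum (X \<omega>) (\<lambda>z. (SUP i. U i) z * indicator A z) * W \<omega> \<partial>M) =
      (\<integral>\<^sup>+\<omega>. (SUP i. point_sum (X \<omega>) (\<lambda>z. U i z * indicator A z) * W \<omega>) \<partial>M)"
      by (simp add: SUP_mult_right_ennreal)
    also have "\<dots> = (SUP i. \<integral>\<^sup>+\<omega>. point_sum (X \<omega>) (\<lambda>z. U i z * indicator A z) * W \<omega> \<partial>M)"
    proof (intro nn_integral_monotone_convergence_SUP)
      show "incseq (\<lambda>i \<omega>. point_sum (X \<omega>) (\<lambda>z. U i z * indicator A z) * W \<omega>)"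
        using seq.hyps(3)
        by (auto simp: incseq_def le_fun_def point_sum_def intro!: mult_right_mono nn_integral_mono)
    qed auto
    also have "\<dots> = (SUP i. \<integral>\<^sup>+z. U i z * indicator A z * \<kappa> z \<partial>\<mu>)"
      by (simp add: seq.IH)
    also have "\<dots> = (\<integral>\<^sup>+z. (SUP i. U i z * indicator A z * \<kappa> z) \<partial>\<mu>)"
      using inc[of "\<lambda>z. indicator A z * \<kappa> z"]
      by (intro nn_integral_monotone_convergence_SUP[symmetric]) (auto simp: mult.assoc)
    finally show ?case
      by (simp add: SUP_mult_right_ennreal image_comp)
  qed
qed

lemma nn_integral_point_sum:
  assumes "f \<in> borel_measurable borel"
  shows "(\<integral>\<^sup>+\<omega>. point_sum (X \<omega>) f \<partial>M) = (\<integral>\<^sup>+z. f z * k z \<partial>\<mu>)"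
  using nn_integral_point_sum_weighted[of "\<lambda>_. 1" k UNIV f] assms
  by (simp add: nn_integral_count)

lemma nn_integral_point_sum_disjoint:
  assumes [measurable]: "A \<in> sets borel" "B \<in> sets borel" and AB: "A \<inter> B = {}"
    and [measurable]: "f \<in> borel_measurable borel" "g \<in> borel_measurable borel"
  shows "(\<integral>\<^sup>+\<omega>. point_sum (X \<omega>) (\<lambda>z. f z * indicator A z) * point_sum (X \<omega>) (\<lambda>z. g z * indicator B z) \<partial>M) =
    (\<integral>\<^sup>+z. \<integral>\<^sup>+w. (f z * indicator A z) * (g w * indicator B w) * \<rho> z w \<partial>\<mu> \<partial>\<mu>)"
proof -
  interpret sigma_finite_measure \<mu> by (rule sigma_finite_mu)
  interpret pair_sigma_finite \<mu> \<mu> by standard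
  have 1: "(\<integral>\<^sup>+\<omega>. point_sum (X \<omega>) (\<lambda>z. f z * indicator A z) * point_sum (X \<omega>) (indicator B') \<partial>M) =
      (\<integral>\<^sup>+z. f z * indicator A z * (\<integral>\<^sup>+w\<in>B'. \<rho> z w \<partial>\<mu>) \<partial>\<mu>)"
    if [measurable]: "B' \<in> sets borel" and "B' \<subseteq> B" for B'
    using AB that(2)
    by (intro nn_integral_point_sum_weighted) (auto intro!: nn_integral_count_pair)
  have 2: "(\<integral>\<^sup>+\<omega>. point_sum (X \<omega>) (\<lambda>w. g w * indicator B w) * point_sum (X \<omega>) (\<lambda>z. f z * indicator A z) \<partial>M) =
    (\<integral>\<^sup>+w. g w * indicator B w * (\<integral>\<^sup>+z. f z * indicator A z * \<rho> z w \<partial>\<mu>) \<partial>\<mu>)"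
  proof (rule nn_integral_point_sum_weighted)
    fix B' :: "complex set" assume B' [measurable]: "B' \<in> sets borel" and "B' \<subseteq> B"
    have "(\<integral>\<^sup>+\<omega>. point_sum (X \<omega>) (indicator B') * point_sum (X \<omega>) (\<lambda>z. f z * indicator A z) \<partial>M) =
      (\<integral>\<^sup>+z. f z * indicator A z * (\<integral>\<^sup>+w\<in>B'. \<rho> z w \<partial>\<mu>) \<partial>\<mu>)"
      using 1[OF B' \<open>B' \<subseteq> B\<close>] by (simp add: mult.commute)
    also have "\<dots> = (\<integral>\<^sup>+z. \<integral>\<^sup>+w. f z * indicator A z * (\<rho> z w * indicator B' w) \<partial>\<mu> \<partial>\<mu>)"
      by (subst nn_integral_cmult) auto
    also have "\<dots> = (\<integral>\<^sup>+w. \<integral>\<^sup>+z. f z * indicator A z * (\<rho> z w * indicator B' w) \<partial>\<mu> \<partial>\<mu>)"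
      by (intro Fubini'[symmetric]) simp
    also have "\<dots> = (\<integral>\<^sup>+w\<in>B'. (\<integral>\<^sup>+z. f z * indicator A z * \<rho> z w \<partial>\<mu>) \<partial>\<mu>)"
      by (subst nn_integral_multc[symmetric]) (auto simp: mult.assoc)
    finally show "(\<integral>\<^sup>+\<omega>. point_sum (X \<omega>) (indicator B') * point_sum (X \<omega>) (\<lambda>z. f z * indicator A z) \<partial>M) =
       (\<integral>\<^sup>+w\<in>B'. (\<integral>\<^sup>+z. f z * indicator A z * \<rho> z w \<partial>\<mu>) \<partial>\<mu>)" .
  qed auto
  also have "(\<integral>\<^sup>+w. g w * indicator B w * (\<integral>\<^sup>+z. f z * indicator A z * \<rho> z w \<partial>\<mu>) \<partial>\<mu>) =
    (\<integral>\<^sup>+w. \<integral>\<^sup>+z. g w * indicator B w * (f z * indicator A z * \<rho> z w) \<partial>\<mu> \<partial>\<mu>)"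
    by (subst nn_integral_cmult) auto
  also have "\<dots> = (\<integral>\<^sup>+z. \<integral>\<^sup>+w. g w * indicator B w * (f z * indicator A z * \<rho> z w) \<partial>\<mu> \<partial>\<mu>)"
    by (intro Fubini') simp
  finally show ?thesis
    by (simp add: ac_simps)
qed

text \<open>
  The intensity identity is only available for disjoint sets. Pairs of points in different dyadic
  cells are covered by finitely many such products, and they increase to all pairs of distinct
  points as the cells shrink.
\<close>
lemma nn_integral_point_sum_off_diagonal:
  assumes f [measurable]: "f \<in> borel_measurable borel" and f0: "\<And>z. 1 \<le> cmod z \<Longrightarrow> f z = 0"
  shows "(\<lambda>\<omega>. \<integral>\<^sup>+z. \<integral>\<^sup>+w. f z * f w * of_bool (z \<noteq> w) \<partial>count_space (X \<omega>) \<partial>count_space (X \<omega>)) \<in> borel_measurable M"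
   (is "?m \<in> _")
    and "(\<integral>\<^sup>+\<omega>. (\<integral>\<^sup>+z. \<integral>\<^sup>+w. f z * f w * of_bool (z \<noteq> w) \<partial>count_space (X \<omega>) \<partial>count_space (X \<omega>)) \<partial>M) =
     (\<integral>\<^sup>+z. \<integral>\<^sup>+w. f z * f w * \<rho> z w \<partial>\<mu> \<partial>\<mu>)"
proof -
  interpret sigma_finite_measure \<mu> by (rule sigma_finite_mu)
  let ?A = "\<lambda>n i. {z. dyadic_cell n z = i}"
  let ?I = "\<lambda>n. unit_disk_cells n"
  define T where "T n \<omega> = (\<Sum>i\<in>?I n. \<Sum>j\<in>?I n - {i}.
    point_sum (X \<omega>) (\<lambda>z. f z * indicator (?A n i) z) * point_sum (X \<omega>) (\<lambda>z. f z * indicator (?A n j) z))" for n \<omega>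
  have cells: "(\<Sum>i\<in>?I n. \<Sum>j\<in>?I n - {i}.
        (f z * indicator (?A n i) z) * (f w * indicator (?A n j) w)) =
      f z * f w * of_bool (dyadic_cell n z \<noteq> dyadic_cell n w)" for n z w
    by (rule sum_dyadic_cells) (rule f0)
  have T_meas [measurable]: "T n \<in> borel_measurable M" for n
    unfolding T_def[abs_def] by measurable
  have T_eq: "T n \<omega> = (\<integral>\<^sup>+z. \<integral>\<^sup>+w. f z * f w * of_bool (dyadic_cell n z \<noteq> dyadic_cell n w) \<partial>count_space (X \<omega>) \<partial>count_space (X \<omega>))" for n \<omega>
  proof -
    have "T n \<omega> = (\<integral>\<^sup>+z. \<integral>\<^sup>+w. (\<Sum>i\<in>?I n. \<Sum>j\<in>?I n - {i}.
        (f z * indicator (?A n i) z) * (f w * indicator (?A n j) w)) \<partial>count_space (X \<omega>) \<partial>count_space (X \<omega>))"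
      unfolding T_def point_sum_def
      by (simp add: nn_integral_sum nn_integral_cmult nn_integral_multc)
    then show ?thesis
      by (simp only: cells)
  qed
  have inc: "incseq (\<lambda>n. F * of_bool (dyadic_cell n z \<noteq> dyadic_cell n w))" for F :: ennreal and z w
    using dyadic_cell_refine by (auto simp: incseq_def of_bool_def)
  have sup: "(SUP n. F * of_bool (dyadic_cell n z \<noteq> dyadic_cell n w)) = F * of_bool (z \<noteq> w)" for F :: ennreal and z w
  proof (cases "z = w")
    case False
    then obtain n where "dyadic_cell n z \<noteq> dyadic_cell n w"
      using dyadic_cell_separates by blast
    then show ?thesis using False
      by (intro antisym SUP_least) (auto intro: SUP_upper2[of n])
  qed simp
  have m_eq: "?m \<omega> = (SUP n. T n \<omega>)" for \<omega>
    unfolding T_eq sup[symmetric] by (rule nn_integral_iterated_SUP) (auto intro: inc)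
  show "?m \<in> borel_measurable M"
    unfolding m_eq by measurable
  have int_T: "(\<integral>\<^sup>+\<omega>. T n \<omega> \<partial>M) = (\<integral>\<^sup>+z. \<integral>\<^sup>+w. f z * f w * \<rho> z w * of_bool (dyadic_cell n z \<noteq> dyadic_cell n w) \<partial>\<mu> \<partial>\<mu>)" for n
  proof -
    have "(\<integral>\<^sup>+\<omega>. T n \<omega> \<partial>M) = (\<Sum>i\<in>?I n. \<Sum>j\<in>?I n - {i}.
     (\<integral>\<^sup>+z. \<integral>\<^sup>+w. (f z * indicator (?A n i) z) * (f w * indicator (?A n j) w) * \<rho> z w \<partial>\<mu> \<partial>\<mu>))"
      unfolding T_def
      by (subst nn_integral_sum, measurable, intro sum.cong refl, subst nn_integral_sum, measurable)
        (auto intro!: sum.cong nn_integral_point_sum_disjoint)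
    also have "\<dots> = (\<integral>\<^sup>+z. \<integral>\<^sup>+w. (\<Sum>i\<in>?I n. \<Sum>j\<in>?I n - {i}.
       (f z * indicator (?A n i) z) * (f w * indicator (?A n j) w)) * \<rho> z w \<partial>\<mu> \<partial>\<mu>)"
      by (simp add: nn_integral_sum sum_distrib_right)
    finally show ?thesis
      unfolding cells by (simp add: ac_simps)
  qed
  have pred: "Measurable.pred (borel \<Otimes>\<^sub>M borel) (\<lambda>(z, w). dyadic_cell n z \<noteq> dyadic_cell n w)" for n
    unfolding dyadic_cell_def by measurable
  have [measurable]: "(\<lambda>(z, w). f z * f w * \<rho> z w * of_bool (dyadic_cell n z \<noteq> dyadic_cell n w))
      \<in> borel_measurable (borel \<Otimes>\<^sub>M borel)" for n
    using pred[of n] by (auto simp: case_prod_beta' intro!: borel_measurable_times)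
  have "(\<integral>\<^sup>+\<omega>. ?m \<omega> \<partial>M) = (SUP n. \<integral>\<^sup>+\<omega>. T n \<omega> \<partial>M)"
    unfolding m_eq
  proof (rule nn_integral_monotone_convergence_SUP)
    show "incseq T"
      unfolding T_eq[abs_def] using inc by (auto simp: incseq_def le_fun_def intro!: nn_integral_mono)
  qed measurable
  also have "\<dots> = (\<integral>\<^sup>+z. \<integral>\<^sup>+w. (SUP n. f z * f w * \<rho> z w * of_bool (dyadic_cell n z \<noteq> dyadic_cell n w)) \<partial>\<mu> \<partial>\<mu>)"
    unfolding int_T by (rule nn_integral_iterated_SUP[symmetric]) (auto intro: inc)
  also have "\<dots> = (\<integral>\<^sup>+z. \<integral>\<^sup>+w. f z * f w * \<rho> z w \<partial>\<mu> \<partial>\<mu>)"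
    unfolding sup by (intro nn_integral_cong) (auto simp: \<rho>_diagonal)
  finally show "(\<integral>\<^sup>+\<omega>. ?m \<omega> \<partial>M) = (\<integral>\<^sup>+z. \<integral>\<^sup>+w. f z * f w * \<rho> z w \<partial>\<mu> \<partial>\<mu>)" .
qed

lemma nn_integral_point_sum_square:
  assumes f [measurable]: "f \<in> borel_measurable borel" and f0: "\<And>z. 1 \<le> cmod z \<Longrightarrow> f z = 0"
  shows "(\<integral>\<^sup>+\<omega>. (point_sum (X \<omega>) f)\<^sup>2 \<partial>M) =
    (\<integral>\<^sup>+z. (f z)\<^sup>2 * k z \<partial>\<mu>) + (\<integral>\<^sup>+z. \<integral>\<^sup>+w. f z * f w * \<rho> z w \<partial>\<mu> \<partial>\<mu>)"
proof -
  have "(point_sum (X \<omega>) f)\<^sup>2 = point_sum (X \<omega>) (\<lambda>z. (f z)\<^sup>2) +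
    (\<integral>\<^sup>+z. \<integral>\<^sup>+w. f z * f w * of_bool (z \<noteq> w) \<partial>count_space (X \<omega>) \<partial>count_space (X \<omega>))" for \<omega>
  proof -
    have diag: "(\<integral>\<^sup>+w. f z * f w * indicator {z} w \<partial>count_space (X \<omega>)) = (f z)\<^sup>2" if "z \<in> X \<omega>" for z
      using that by (subst nn_integral_indicator_singleton) (auto simp: power2_eq_square)
    have "(point_sum (X \<omega>) f)\<^sup>2 = (\<integral>\<^sup>+z. \<integral>\<^sup>+w. f z * f w \<partial>count_space (X \<omega>) \<partial>count_space (X \<omega>))"
      unfolding point_sum_def power2_eq_square by (simp add: nn_integral_cmult nn_integral_multc)
    also have "\<dots> = (\<integral>\<^sup>+z. \<integral>\<^sup>+w. f z * f w * indicator {z} w + f z * f w * of_bool (z \<noteq> w) \<partial>count_space (X \<omega>) \<partial>count_space (X \<omega>))"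
      by (intro nn_integral_cong) (auto simp: indicator_def)
    also have "\<dots> = (\<integral>\<^sup>+z. (f z)\<^sup>2 + (\<integral>\<^sup>+w. f z * f w * of_bool (z \<noteq> w) \<partial>count_space (X \<omega>)) \<partial>count_space (X \<omega>))"
      by (intro nn_integral_cong) (simp add: nn_integral_add diag power2_eq_square)
    finally show ?thesis
      by (simp add: nn_integral_add point_sum_def power2_eq_square)
  qed
  then show ?thesis
    using nn_integral_point_sum_off_diagonal[OF f f0]
    by (simp add: nn_integral_add nn_integral_point_sum)
qed

end

section \<open>The variance of linear statistics of the hyperbolic process\<close>

lemma det_mat_2:
  "Determinant.det (Matrix.mat 2 2 f) = f (0, 0) * f (1, 1) - f (0, 1) * f (1, 0 :: nat)"
  for f :: "nat \<times> nat \<Rightarrow> complex"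
proof -
  have "Determinant.det (Matrix.mat 2 2 f) =
      (\<Sum>j<2. Matrix.mat 2 2 f $$ (0, j) * cofactor (Matrix.mat 2 2 f) 0 j)"
    by (rule laplace_expansion_row[of _ 2]) auto
  also have "\<dots> = f (0, 0) * f (1, 1) - f (0, 1) * f (1, 0)"
    by (simp add: numeral_2_eq_2 cofactor_def mat_delete_def det_single)
  finally show ?thesis .
qed

text \<open>The one-point intensity \<open>disk_kernel L z z\<close> for \<open>z\<close> in the disk.\<close>
definition disk_intensity :: "real \<Rightarrow> complex \<Rightarrow> real" where
  "disk_intensity L z = (1 - (cmod z)\<^sup>2) powr (- (L + 1))"

text \<open>The squared modulus of \<open>disk_kernel L z w\<close> for \<open>z\<close> and \<open>w\<close> in the disk.\<close>
definition disk_kernel_sq :: "real \<Rightarrow> complex \<Rightarrow> complex \<Rightarrow> real" where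
  "disk_kernel_sq L z w = cmod (1 - z * cnj w) powr (- 2 * (L + 1))"

lemma borel_measurable_disk_intensity [measurable]:
  "disk_intensity L \<in> borel_measurable borel"
  unfolding disk_intensity_def[abs_def] by measurable

lemma borel_measurable_disk_kernel_sq [measurable]:
  "(\<lambda>(z, w). disk_kernel_sq L z w) \<in> borel_measurable (borel \<Otimes>\<^sub>M borel)"
  unfolding disk_kernel_sq_def[abs_def] by measurable

lemma disk_intensity_nonneg [simp]: "0 \<le> disk_intensity L z"
  and disk_kernel_sq_nonneg [simp]: "0 \<le> disk_kernel_sq L z w"
  by (auto simp: disk_intensity_def disk_kernel_sq_def)

lemma disk_kernel_sq_commute: "disk_kernel_sq L z w = disk_kernel_sq L w z"
proof -
  have "cmod (1 - z * cnj w) = cmod (cnj (1 - w * cnj z))"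
    by (simp add: mult.commute)
  then show ?thesis
    unfolding disk_kernel_sq_def complex_mod_cnj by simp
qed

lemma disk_kernel_diagonal:
  assumes "cmod z < 1"
  shows "disk_kernel L z z = complex_of_real (disk_intensity L z)"
proof -
  have pos: "0 < 1 - (cmod z)\<^sup>2"
    using assms by (auto simp: abs_square_less_1)
  have "1 - z * cnj z = complex_of_real (1 - (cmod z)\<^sup>2)"
    using complex_norm_square[of z] by simp
  then have "(1 - z * cnj z) powr complex_of_real (L + 1) = complex_of_real ((1 - (cmod z)\<^sup>2) powr (L + 1))"
    using pos powr_of_real[of "1 - (cmod z)\<^sup>2" "L + 1"] by simp
  then show ?thesis
    unfolding disk_kernel_def disk_intensity_def powr_minus_divide by simp
qed

lemma disk_kernel_mult_swap:
  assumes "cmod z < 1" "cmod w < 1"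
  shows "disk_kernel L z w * disk_kernel L w z = complex_of_real (disk_kernel_sq L z w)"
proof -
  have nz: "1 - z * cnj w \<noteq> 0"
    using one_minus_mult_cnj_nz[OF assms(2,1)] by (simp add: mult.commute)
  have "cmod (z * cnj w) < 1 * 1"
    unfolding norm_mult complex_mod_cnj using assms by (intro mult_strict_mono) auto
  then have "Re (1 - z * cnj w) > 0"
    using complex_Re_le_cmod[of "z * cnj w"] by simp
  then have "cnj ((1 - z * cnj w) powr complex_of_real (L + 1)) = (1 - w * cnj z) powr complex_of_real (L + 1)"
    by (subst cnj_powr) (auto simp: mult.commute)
  then have "disk_kernel L w z = cnj (disk_kernel L z w)"
    unfolding disk_kernel_def by simp
  then have "disk_kernel L z w * disk_kernel L w z = complex_of_real ((cmod (disk_kernel L z w))\<^sup>2)"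
    using complex_norm_square[of "disk_kernel L z w"] by simp
  also have "cmod (disk_kernel L z w) = cmod (1 - z * cnj w) powr (- (L + 1))"
    unfolding disk_kernel_def norm_divide powr_minus_divide
    by (subst norm_powr_real_powr') auto
  also have "(cmod (1 - z * cnj w) powr (- (L + 1)))\<^sup>2 = disk_kernel_sq L z w"
    unfolding disk_kernel_sq_def power2_eq_square by (simp add: powr_add[symmetric])
  finally show ?thesis .
qed

lemma disk_kernel_sq_diagonal:
  assumes "cmod z < 1"
  shows "disk_kernel_sq L z z = disk_intensity L z * disk_intensity L z"
  using disk_kernel_mult_swap[OF assms assms, of L]
  unfolding disk_kernel_diagonal[OF assms] of_real_mult[symmetric] of_real_eq_iff by simp

lemma disk_kernel_sq_le:
  assumes "0 < L" "cmod z < 1" "cmod w < 1"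
  shows "disk_kernel_sq L z w \<le> disk_intensity L z * disk_intensity L w"
proof -
  have pos: "0 < 1 - (cmod z)\<^sup>2" "0 < 1 - (cmod w)\<^sup>2"
    using assms by (auto simp: abs_square_less_1)
  have "(1 - (cmod z)\<^sup>2) * (1 - (cmod w)\<^sup>2) \<le> (cmod (1 - z * cnj w))\<^sup>2"
  proof -
    have "0 \<le> (cmod (w - z))\<^sup>2" by simp
    then have "(1 - (cmod w)\<^sup>2) * (1 - (cmod z)\<^sup>2) \<le> (cmod (1 - cnj w * z))\<^sup>2"
      using cmod_one_minus_mult_cnj_sq[of w z] by linarith
    then show ?thesis by (simp only: mult.commute)
  qed
  then have "((cmod (1 - z * cnj w))\<^sup>2) powr (- (L + 1)) \<le> ((1 - (cmod z)\<^sup>2) * (1 - (cmod w)\<^sup>2)) powr (- (L + 1))"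
    using pos assms(1) by (intro powr_mono2') auto
  moreover have "((cmod (1 - z * cnj w))\<^sup>2) powr (- (L + 1)) = disk_kernel_sq L z w"
    unfolding disk_kernel_sq_def power2_eq_square
    by (simp add: powr_mult powr_add[symmetric])
  ultimately show ?thesis
    using pos by (simp add: disk_intensity_def powr_mult)
qed

lemma nn_integral_disk_kernel_sq:
  assumes "0 < L" "cmod z < 1"
  shows "(\<integral>\<^sup>+w. ennreal (disk_kernel_sq L z w) \<partial>disk_measure L) = ennreal (disk_intensity L z)"
  using nn_integral_kernel_sq[OF assms] by (simp add: disk_kernel_sq_def disk_intensity_def)

text \<open>The two-by-two determinant of the kernel: the two-point intensity on the disk.\<close>
definition disk_pair_intensity :: "real \<Rightarrow> complex \<Rightarrow> complex \<Rightarrow> real" where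
  "disk_pair_intensity L z w = disk_intensity L z * disk_intensity L w - disk_kernel_sq L z w"

text \<open>
  The indicators extend the intensities by zero from the disk to the plane.
\<close>
lemma pair_intensity_hyperbolic_dpp:
  assumes L: "0 < L" and "hyperbolic_dpp L M X"
  shows "pair_intensity M X (disk_measure L)
    (\<lambda>z. ennreal (disk_intensity L z) * indicator unit_disk z)
    (\<lambda>z w. ennreal (disk_pair_intensity L z w) * (indicator unit_disk z * indicator unit_disk w))"
proof -
  let ?D = "unit_disk" and ?\<mu> = "disk_measure L"
  interpret mu: prob_space ?\<mu> by (rule prob_space_disk_measure[OF L])
  interpret product_sigma_finite "\<lambda>_::nat. ?\<mu>"
    by (simp add: product_sigma_finite_def mu.sigma_finite_measure_axioms)
  have spp: "simple_point_process M ?D X"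
    using assms(2) by (simp only: hyperbolic_dpp_def determinantal_process_def)
  have "\<exists>\<rho>. has_joint_intensities M ?D X ?\<mu> \<rho> \<and>
      (\<forall>k\<ge>1. \<forall>x \<in> {..<k} \<rightarrow>\<^sub>E ?D.
         complex_of_real (\<rho> k x) = Determinant.det (Matrix.mat k k (\<lambda>(i, j). disk_kernel L (x i) (x j))))"
    using assms(2) by (simp only: hyperbolic_dpp_def determinantal_process_def)
  then obtain \<rho> where J: "has_joint_intensities M ?D X ?\<mu> \<rho>" and
    \<rho>': "\<forall>k\<ge>1. \<forall>x \<in> {..<k} \<rightarrow>\<^sub>E ?D.
       complex_of_real (\<rho> k x) = Determinant.det (Matrix.mat k k (\<lambda>(i, j). disk_kernel L (x i) (x j)))"
    by (elim exE conjE) (rule that)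
  have \<rho>: "complex_of_real (\<rho> k x) = Determinant.det (Matrix.mat k k (\<lambda>(i, j). disk_kernel L (x i) (x j)))"
    if "1 \<le> k" "x \<in> {..<k} \<rightarrow>\<^sub>E ?D" for k x
    by (rule \<rho>'[THEN spec, THEN mp, THEN bspec, OF that])
  have \<rho>1: "\<rho> 1 x = disk_intensity L (x 0)" if "x \<in> {..<1} \<rightarrow>\<^sub>E ?D" for x
  proof -
    have "x 0 \<in> ?D" by (rule PiE_mem[OF that]) simp
    then have "complex_of_real (\<rho> 1 x) = complex_of_real (disk_intensity L (x 0))"
      unfolding \<rho>[OF order_refl that] by (subst det_single) (auto simp: disk_kernel_diagonal)
    then show ?thesis by simp
  qed
  have \<rho>2: "\<rho> 2 x = disk_pair_intensity L (x 0) (x 1)" if "x \<in> {..<2} \<rightarrow>\<^sub>E ?D" for x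
  proof -
    have D: "x 0 \<in> ?D" "x 1 \<in> ?D" by (rule PiE_mem[OF that], simp)+
    have "complex_of_real (\<rho> 2 x) = complex_of_real (disk_intensity L (x 0)) * complex_of_real (disk_intensity L (x 1))
       - disk_kernel L (x 0) (x 1) * disk_kernel L (x 1) (x 0)"
      using D unfolding \<rho>[OF one_le_numeral that] det_mat_2 by (simp add: disk_kernel_diagonal)
    also have "\<dots> = complex_of_real (disk_pair_intensity L (x 0) (x 1))"
      using D by (simp add: disk_kernel_mult_swap disk_pair_intensity_def)
    finally show ?thesis by simp
  qed
  have J': "(\<integral>\<^sup>+\<omega>. (\<Prod>i<k. emeasure (count_space UNIV) (X \<omega> \<inter> B i)) \<partial>M) =
       (\<integral>\<^sup>+x \<in> Pi\<^sub>E {..<k} B. ennreal (\<rho> k x) \<partial>(\<Pi>\<^sub>M i\<in>{..<k}. ?\<mu>))"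
    if "1 \<le> k" "\<forall>i<k. B i \<in> sets borel \<and> B i \<subseteq> ?D" "disjoint_family_on B {..<k}" for k B
    by (rule J[unfolded has_joint_intensities_def, THEN spec, THEN mp, OF that(1), THEN conjunct2,
          THEN spec, THEN mp, OF conjI[OF that(2,3)]])
  have X_D: "X \<omega> \<subseteq> ?D" if "\<omega> \<in> space M" for \<omega>
    using spp that unfolding simple_point_process_def by blast
  have count: "point_sum (X \<omega>) (indicator B) = emeasure (count_space UNIV) (X \<omega> \<inter> (B \<inter> ?D))"
    if "\<omega> \<in> space M" for \<omega> B
    using X_D[OF that] unfolding point_sum_indicator
    by (intro arg_cong[where f = "emeasure _"]) auto
  show ?thesis
  proof
    fix B :: "complex set" assume B [measurable]: "B \<in> sets borel"
    have "(\<lambda>\<omega>. emeasure (count_space UNIV) (X \<omega> \<inter> (B \<inter> ?D))) \<in> borel_measurable M"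
      using spp B unfolding simple_point_process_def by auto
    then show "(\<lambda>\<omega>. point_sum (X \<omega>) (indicator B)) \<in> borel_measurable M"
      by (subst measurable_cong[OF count])
    have "(\<integral>\<^sup>+\<omega>. (\<Prod>i<(1::nat). emeasure (count_space UNIV) (X \<omega> \<inter> (B \<inter> ?D))) \<partial>M) =
       (\<integral>\<^sup>+x \<in> Pi\<^sub>E {..<1} (\<lambda>_. B \<inter> ?D). ennreal (\<rho> 1 x) \<partial>(\<Pi>\<^sub>M i\<in>{..<1}. ?\<mu>))"
      by (rule J') (auto simp: disjoint_family_on_def)
    also have "\<dots> = (\<integral>\<^sup>+x. (ennreal (disk_intensity L (x 0)) * indicator ?D (x 0)) * indicator B (x 0) \<partial>(\<Pi>\<^sub>M i\<in>{0::nat}. ?\<mu>))"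
    proof -
      have pt: "ennreal (\<rho> 1 x) * indicator (Pi\<^sub>E {..<1} (\<lambda>_. B \<inter> ?D)) x =
          (ennreal (disk_intensity L (x 0)) * indicator ?D (x 0)) * indicator B (x 0)"
        if "x \<in> space (\<Pi>\<^sub>M i\<in>{0::nat}. ?\<mu>)" for x
      proof -
        have ext: "x \<in> extensional {..<1}"
          using that by (auto simp: space_PiM PiE_def extensional_def)
        then have iff: "x \<in> Pi\<^sub>E {..<1} (\<lambda>_. C) \<longleftrightarrow> x 0 \<in> C" for C
          by (simp add: PiE_iff lessThan_Suc)
        show ?thesis
          using \<rho>1[of x] iff[of ?D] iff[of "B \<inter> ?D"] by (auto simp: indicator_def)
      qed
      have PM: "(\<Pi>\<^sub>M i\<in>{..<1}. ?\<mu>) = (\<Pi>\<^sub>M i\<in>{0::nat}. ?\<mu>)"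
        by (simp add: lessThan_Suc)
      show ?thesis
        unfolding PM by (rule nn_integral_cong) (rule pt)
    qed
    also have "\<dots> = (\<integral>\<^sup>+z\<in>B. (ennreal (disk_intensity L z) * indicator ?D z) \<partial>?\<mu>)"
      by (rule product_nn_integral_singleton) measurable
    finally show "(\<integral>\<^sup>+\<omega>. point_sum (X \<omega>) (indicator B) \<partial>M) =
        (\<integral>\<^sup>+z\<in>B. (ennreal (disk_intensity L z) * indicator ?D z) \<partial>?\<mu>)"
      by (simp add: count cong: nn_integral_cong_simp)
  next
    fix A B :: "complex set"
    assume A [measurable]: "A \<in> sets borel" and B [measurable]: "B \<in> sets borel" and AB: "A \<inter> B = {}"
    let ?B = "\<lambda>i::nat. if i = 0 then A \<inter> ?D else B \<inter> ?D"
    let ?g = "\<lambda>z w. ennreal (disk_pair_intensity L z w) * (indicator ?D z * indicator ?D w) * indicator B w * indicator A z"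
    have g: "case_prod ?g \<in> borel_measurable (borel \<Otimes>\<^sub>M borel)"
      unfolding disk_pair_intensity_def by measurable
    have "(\<integral>\<^sup>+\<omega>. (\<Prod>i<(2::nat). emeasure (count_space UNIV) (X \<omega> \<inter> ?B i)) \<partial>M) =
       (\<integral>\<^sup>+x \<in> Pi\<^sub>E {..<2} ?B. ennreal (\<rho> 2 x) \<partial>(\<Pi>\<^sub>M i\<in>{..<2}. ?\<mu>))"
      using AB by (intro J') (auto simp: disjoint_family_on_def)
    also have "\<dots> = (\<integral>\<^sup>+x. ?g (x 0) (x 1) \<partial>(\<Pi>\<^sub>M i\<in>{0, 1::nat}. ?\<mu>))"
    proof -
      have pt: "ennreal (\<rho> 2 x) * indicator (Pi\<^sub>E {..<2} ?B) x = ?g (x 0) (x 1)"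
        if "x \<in> space (\<Pi>\<^sub>M i\<in>{0, 1::nat}. ?\<mu>)" for x
      proof -
        have ext: "x \<in> extensional {..<2}"
          using that by (auto simp: space_PiM PiE_def extensional_def)
        then have iff: "x \<in> Pi\<^sub>E {..<2} C \<longleftrightarrow> x 0 \<in> C 0 \<and> x 1 \<in> C 1" for C
          by (auto simp: PiE_iff numeral_2_eq_2 lessThan_Suc)
        show ?thesis
          using \<rho>2[of x] iff[of "\<lambda>_. ?D"] iff[of ?B] by (auto simp: indicator_def)
      qed
      have PM: "(\<Pi>\<^sub>M i\<in>{..<2}. ?\<mu>) = (\<Pi>\<^sub>M i\<in>{0, 1::nat}. ?\<mu>)"
        by (intro arg_cong[where f = "\<lambda>I. Pi\<^sub>M I _"]) auto
      show ?thesis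
        unfolding PM by (rule nn_integral_cong) (rule pt)
    qed
    also have "\<dots> = (\<integral>\<^sup>+z. ?g (fst z) (snd z) \<partial>(?\<mu> \<Otimes>\<^sub>M ?\<mu>))"
      using g by (intro product_nn_integral_pair) auto
    also have "\<dots> = (\<integral>\<^sup>+z. \<integral>\<^sup>+w. ?g z w \<partial>?\<mu> \<partial>?\<mu>)"
      using g by (subst mu.nn_integral_fst[symmetric]) (auto simp: case_prod_beta')
    also have "\<dots> = (\<integral>\<^sup>+z\<in>A. (\<integral>\<^sup>+w\<in>B. (ennreal (disk_pair_intensity L z w) * (indicator ?D z * indicator ?D w)) \<partial>?\<mu>) \<partial>?\<mu>)"
      by (intro nn_integral_cong) (auto split: split_indicator)
    finally show "(\<integral>\<^sup>+\<omega>. point_sum (X \<omega>) (indicator A) * point_sum (X \<omega>) (indicator B) \<partial>M) =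
      (\<integral>\<^sup>+z\<in>A. (\<integral>\<^sup>+w\<in>B. (ennreal (disk_pair_intensity L z w) * (indicator ?D z * indicator ?D w)) \<partial>?\<mu>) \<partial>?\<mu>)"
      by (simp add: count numeral_2_eq_2 lessThan_Suc mult.commute cong: nn_integral_cong_simp)
  qed (auto simp: mu.sigma_finite_measure_axioms disk_pair_intensity_def disk_kernel_sq_diagonal split: split_indicator)
qed

lemma ennreal_linear_statistic:
  assumes fin: "finite (X \<omega> \<inter> cball 0 r)" and f: "\<And>z. 0 \<le> f z" "\<And>z. r < cmod z \<Longrightarrow> f z = 0"
  shows "ennreal (linear_statistic X f \<omega>) = point_sum (X \<omega>) (\<lambda>z. ennreal (f z))"
    and "0 \<le> linear_statistic X f \<omega>"
proof -
  let ?F = "X \<omega> \<inter> cball 0 r"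
  have "linear_statistic X f \<omega> = infsum f ?F"
    unfolding linear_statistic_def
    by (intro infsum_cong_neutral) (auto simp: f not_le)
  then have eq: "linear_statistic X f \<omega> = sum f ?F"
    using fin by simp
  show "0 \<le> linear_statistic X f \<omega>"
    unfolding eq using f by (auto intro: sum_nonneg)
  have "point_sum (X \<omega>) (\<lambda>z. ennreal (f z)) = (\<Sum>z\<in>?F. ennreal (f z))"
    unfolding point_sum_def using fin f
    by (intro nn_integral_count_space') (auto simp: not_le)
  then show "ennreal (linear_statistic X f \<omega>) = point_sum (X \<omega>) (\<lambda>z. ennreal (f z))"
    unfolding eq using f by (simp add: sum_ennreal)
qed

text \<open>
  The variance formula, stated as a sum because the subtraction of extended nonnegative reals is
  truncated.
\<close>
lemma variance_linear_statistic:
  assumes L: "0 < L" and dpp: "hyperbolic_dpp L M X" and r: "0 < r" "r < 1"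
    and f [measurable]: "f \<in> borel_measurable borel" and f01: "\<And>z. 0 \<le> f z" "\<And>z. f z \<le> 1"
    and f0: "\<And>z. r < cmod z \<Longrightarrow> f z = 0"
  defines "V \<equiv> prob_space.variance M (linear_statistic X f)"
    and "a \<equiv> \<integral>\<^sup>+z. ennreal ((f z)\<^sup>2 * disk_intensity L z) \<partial>disk_measure L"
    and "b \<equiv> \<integral>\<^sup>+z. \<integral>\<^sup>+w. ennreal (f z * f w * disk_kernel_sq L z w) \<partial>disk_measure L \<partial>disk_measure L"
  shows "0 \<le> V" and "ennreal V + b = a" and "b < \<infinity>"
proof -
  let ?\<mu> = "disk_measure L" and ?D = "unit_disk" and ?S = "linear_statistic X f"
  interpret mu: prob_space ?\<mu> by (rule prob_space_disk_measure[OF L])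
  interpret pair_intensity M X "disk_measure L"
    "\<lambda>z. ennreal (disk_intensity L z) * indicator unit_disk z"
    "\<lambda>z w. ennreal (disk_pair_intensity L z w) * (indicator unit_disk z * indicator unit_disk w)"
    by (rule pair_intensity_hyperbolic_dpp[OF L dpp])
  have spp: "simple_point_process M ?D X"
    using dpp unfolding hyperbolic_dpp_def determinantal_process_def by blast
  interpret prob_space M
    using spp unfolding simple_point_process_def by blast
  have f_disk: "f z = 0" if "z \<notin> ?D" for z
    using that r by (intro f0) auto
  have fin: "finite (X \<omega> \<inter> cball 0 r)" if "\<omega> \<in> space M" for \<omega>
    using spp that r unfolding simple_point_process_def by (auto simp: subset_iff)
  have S: "ennreal (?S \<omega>) = point_sum (X \<omega>) (\<lambda>z. ennreal (f z))" "0 \<le> ?S \<omega>" if "\<omega> \<in> space M" for \<omega>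
    by (rule ennreal_linear_statistic[of X \<omega> r f]; use fin[OF that] f01(1) f0 in simp)+
  have ps_meas: "(\<lambda>\<omega>. point_sum (X \<omega>) (\<lambda>z. ennreal (f z))) \<in> borel_measurable M"
    by (rule measurable_point_sum) measurable
  have S_eq: "?S \<omega> = enn2real (point_sum (X \<omega>) (\<lambda>z. ennreal (f z)))" if "\<omega> \<in> space M" for \<omega>
    using S[OF that] by (metis enn2real_ennreal)
  have S_meas [measurable]: "?S \<in> borel_measurable M"
    by (subst measurable_cong[OF S_eq]) (use ps_meas in measurable)
  define m where "m = (\<integral>\<^sup>+z. ennreal (f z * disk_intensity L z) \<partial>?\<mu>)"
  define c where "c = (\<integral>\<^sup>+z. \<integral>\<^sup>+w. ennreal (f z * f w * disk_pair_intensity L z w) \<partial>?\<mu> \<partial>?\<mu>)"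
  have ES: "(\<integral>\<^sup>+\<omega>. ennreal (?S \<omega>) \<partial>M) = m"
  proof -
    have "(\<integral>\<^sup>+\<omega>. ennreal (?S \<omega>) \<partial>M) = (\<integral>\<^sup>+\<omega>. point_sum (X \<omega>) (\<lambda>z. ennreal (f z)) \<partial>M)"
      by (intro nn_integral_cong S)
    also have "\<dots> = (\<integral>\<^sup>+z. ennreal (f z) * (ennreal (disk_intensity L z) * indicator ?D z) \<partial>?\<mu>)"
      by (rule nn_integral_point_sum) measurable
    also have "\<dots> = m"
      unfolding m_def using f01(1) f_disk
      by (intro nn_integral_cong) (auto simp: ennreal_mult split: split_indicator)
    finally show ?thesis .
  qed
  have ES2: "(\<integral>\<^sup>+\<omega>. ennreal ((?S \<omega>)\<^sup>2) \<partial>M) = a + c"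
  proof -
    have "(\<integral>\<^sup>+\<omega>. ennreal ((?S \<omega>)\<^sup>2) \<partial>M) = (\<integral>\<^sup>+\<omega>. (point_sum (X \<omega>) (\<lambda>z. ennreal (f z)))\<^sup>2 \<partial>M)"
      by (intro nn_integral_cong) (simp add: S ennreal_power[symmetric])
    also have "\<dots> = (\<integral>\<^sup>+z. (ennreal (f z))\<^sup>2 * (ennreal (disk_intensity L z) * indicator ?D z) \<partial>?\<mu>) +
       (\<integral>\<^sup>+z. \<integral>\<^sup>+w. ennreal (f z) * ennreal (f w) * (ennreal (disk_pair_intensity L z w) * (indicator ?D z * indicator ?D w)) \<partial>?\<mu> \<partial>?\<mu>)"
      by (rule nn_integral_point_sum_square) (use r in \<open>auto simp: f0\<close>)
    also have "(\<integral>\<^sup>+z. (ennreal (f z))\<^sup>2 * (ennreal (disk_intensity L z) * indicator ?D z) \<partial>?\<mu>) = a"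
      unfolding a_def using f01(1) f_disk
      by (intro nn_integral_cong) (auto simp: ennreal_mult ennreal_power split: split_indicator)
    also have "(\<integral>\<^sup>+z. \<integral>\<^sup>+w. ennreal (f z) * ennreal (f w) * (ennreal (disk_pair_intensity L z w) * (indicator ?D z * indicator ?D w)) \<partial>?\<mu> \<partial>?\<mu>) = c"
      unfolding c_def using f01(1) f_disk
      by (intro nn_integral_cong) (auto simp: ennreal_mult' ennreal_mult'' split: split_indicator)
    finally show ?thesis .
  qed
  have k2_le: "disk_kernel_sq L z w \<le> disk_intensity L z * disk_intensity L w" if "z \<in> ?D" "w \<in> ?D" for z w
    using that disk_kernel_sq_le[OF L, of z w] by auto
  \<comment> \<open>The two-point intensity is \<open>k(z) k(w) - k\<^sub>2(z, w)\<close>, so \<open>c\<close> and \<open>b\<close> add up to the squared mean.\<close>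
  have cb: "c + b = m\<^sup>2"
  proof -
    have "c + b = (\<integral>\<^sup>+z. \<integral>\<^sup>+w. ennreal (f z * f w * disk_pair_intensity L z w) + ennreal (f z * f w * disk_kernel_sq L z w) \<partial>?\<mu> \<partial>?\<mu>)"
      unfolding b_def c_def disk_pair_intensity_def
      by (subst nn_integral_add[symmetric], measurable, intro nn_integral_cong, subst nn_integral_add) auto
    also have "\<dots> = (\<integral>\<^sup>+z. \<integral>\<^sup>+w. ennreal (f z * disk_intensity L z) * ennreal (f w * disk_intensity L w) \<partial>?\<mu> \<partial>?\<mu>)"
    proof (intro nn_integral_cong)
      fix z w
      show "ennreal (f z * f w * disk_pair_intensity L z w) + ennreal (f z * f w * disk_kernel_sq L z w) =
        ennreal (f z * disk_intensity L z) * ennreal (f w * disk_intensity L w)"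
      proof (cases "z \<in> ?D \<and> w \<in> ?D")
        case True
        then show ?thesis
          using f01(1) k2_le[of z w]
          by (simp add: disk_pair_intensity_def ennreal_mult'[symmetric] ac_simps
              ennreal_plus[symmetric] right_diff_distrib mult_left_mono del: ennreal_plus)
      qed (auto simp: f_disk)
    qed
    also have "\<dots> = m\<^sup>2"
      unfolding m_def power2_eq_square by (simp add: nn_integral_cmult nn_integral_multc)
    finally show ?thesis .
  qed
  have bound: "f z * disk_intensity L z \<le> (1 - r\<^sup>2) powr (- (L + 1))" for z
  proof (cases "cmod z \<le> r")
    case True
    have r2: "0 < 1 - r\<^sup>2" using r by (simp add: power_less_one_iff)
    have "(cmod z)\<^sup>2 \<le> r\<^sup>2" using True by (intro power_mono) auto
    then have "disk_intensity L z \<le> (1 - r\<^sup>2) powr (- (L + 1))"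
      unfolding disk_intensity_def using r2 L by (intro powr_mono2') auto
    then show ?thesis
      using f01[of z] mult_mono[of "f z" 1 "disk_intensity L z"] by simp
  qed (simp add: f0)
  have m_fin: "m < \<infinity>"
  proof -
    have "m \<le> (\<integral>\<^sup>+z. ennreal ((1 - r\<^sup>2) powr (- (L + 1))) \<partial>?\<mu>)"
      unfolding m_def by (intro nn_integral_mono ennreal_leI bound)
    then show ?thesis
      using mu.emeasure_space_1 by (auto intro: le_less_trans)
  qed
  have a_fin: "a < \<infinity>"
  proof -
    have "a \<le> m"
      unfolding a_def m_def
      by (intro nn_integral_mono ennreal_leI mult_right_mono) (use f01 in \<open>auto simp: power2_eq_square mult_left_le\<close>)
    then show ?thesis using m_fin by (rule le_less_trans)
  qed
  from cb m_fin have bc_fin: "b < \<infinity>" "c < \<infinity>"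
  proof -
    have "m\<^sup>2 < \<infinity>"
      using m_fin by (simp add: power2_eq_square ennreal_mult_less_top)
    then show "b < \<infinity>" "c < \<infinity>"
      unfolding cb[symmetric] by simp_all
  qed
  then show "b < \<infinity>" by simp
  define m' a' b' c' where "m' = enn2real m" and "a' = enn2real a" and "b' = enn2real b" and "c' = enn2real c"
  then have eqs: "m = ennreal m'" "a = ennreal a'" "b = ennreal b'" "c = ennreal c'"
    and nn: "0 \<le> m'" "0 \<le> a'" "0 \<le> b'" "0 \<le> c'"
    using m_fin a_fin bc_fin by simp_all
  have S_int: "has_bochner_integral M ?S m'"
    using ES S(2) nn by (intro has_bochner_integral_nn_integral) (auto simp: eqs)
  have S2_int: "has_bochner_integral M (\<lambda>\<omega>. (?S \<omega>)\<^sup>2) (a' + c')"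
    using ES2 nn by (intro has_bochner_integral_nn_integral) (auto simp: eqs)
  have "V = a' + c' - m'\<^sup>2"
    unfolding V_def using S_int S2_int
    by (subst variance_eq) (auto simp: has_bochner_integral_iff)
  moreover have "c' + b' = m'\<^sup>2"
    using cb nn unfolding eqs by (simp add: ennreal_power flip: ennreal_plus)
  ultimately have V: "V = a' - b'" by simp
  show "0 \<le> V"
    unfolding V_def by (intro integral_nonneg_AE) auto
  then show "ennreal V + b = a"
    unfolding eqs using V nn by (simp flip: ennreal_plus)
qed

lemma variance_linear_statistic_le:
  assumes L: "0 < L" and dpp: "hyperbolic_dpp L M X" and r: "0 < r" "r < 1"
    and f: "f \<in> borel_measurable borel" "\<And>z. 0 \<le> f z" "\<And>z. f z \<le> 1" "\<And>z. r < cmod z \<Longrightarrow> f z = 0"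
  shows "ennreal (prob_space.variance M (linear_statistic X f)) \<le>
     (\<integral>\<^sup>+z. ennreal ((f z)\<^sup>2 * disk_intensity L z) \<partial>disk_measure L)"
  by (rule order_trans[OF _ eq_refl[OF variance_linear_statistic(2)[OF assms]]]) simp

text \<open>
  By the reproducing property, \<open>\<integral> f\<^sup>2 k d\<mu>\<close> equals \<open>\<integral>\<integral> f(z)\<^sup>2 k\<^sub>2(z, w) d\<mu> d\<mu>\<close>, and by symmetry the same
  with \<open>f(w)\<^sup>2\<close>; completing the square turns the variance formula into an energy.
\<close>
lemma variance_linear_statistic_dirichlet:
  assumes L: "0 < L" and dpp: "hyperbolic_dpp L M X" and r: "0 < r" "r < 1"
    and f [measurable]: "f \<in> borel_measurable borel" and f01: "\<And>z. 0 \<le> f z" "\<And>z. f z \<le> 1"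
    and f0: "\<And>z. r < cmod z \<Longrightarrow> f z = 0"
  shows "2 * ennreal (prob_space.variance M (linear_statistic X f)) =
     (\<integral>\<^sup>+z. \<integral>\<^sup>+w. ennreal ((f z - f w)\<^sup>2 * disk_kernel_sq L z w) \<partial>disk_measure L \<partial>disk_measure L)"
proof -
  let ?\<mu> = "disk_measure L"
  define V where "V = prob_space.variance M (linear_statistic X f)"
  define a where "a = (\<integral>\<^sup>+z. ennreal ((f z)\<^sup>2 * disk_intensity L z) \<partial>?\<mu>)"
  define b where "b = (\<integral>\<^sup>+z. \<integral>\<^sup>+w. ennreal (f z * f w * disk_kernel_sq L z w) \<partial>?\<mu> \<partial>?\<mu>)"
  define e where "e = (\<integral>\<^sup>+z. \<integral>\<^sup>+w. ennreal ((f z - f w)\<^sup>2 * disk_kernel_sq L z w) \<partial>?\<mu> \<partial>?\<mu>)"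
  have Vab: "ennreal V + b = a" "b < \<infinity>"
    using variance_linear_statistic(2,3)[OF assms] unfolding V_def a_def b_def by auto
  interpret mu: prob_space ?\<mu> by (rule prob_space_disk_measure[OF L])
  interpret pair_sigma_finite ?\<mu> ?\<mu> by standard
  have a1: "a = (\<integral>\<^sup>+z. \<integral>\<^sup>+w. ennreal ((f z)\<^sup>2 * disk_kernel_sq L z w) \<partial>?\<mu> \<partial>?\<mu>)"
    unfolding a_def
  proof (intro nn_integral_cong)
    fix z
    show "ennreal ((f z)\<^sup>2 * disk_intensity L z) = (\<integral>\<^sup>+w. ennreal ((f z)\<^sup>2 * disk_kernel_sq L z w) \<partial>?\<mu>)"
    proof (cases "cmod z < 1")
      case True
      then show ?thesis
        by (simp add: ennreal_mult nn_integral_cmult nn_integral_disk_kernel_sq[OF L])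
    qed (use r in \<open>simp add: f0\<close>)
  qed
  have a2: "a = (\<integral>\<^sup>+z. \<integral>\<^sup>+w. ennreal ((f w)\<^sup>2 * disk_kernel_sq L z w) \<partial>?\<mu> \<partial>?\<mu>)"
    unfolding a1 by (subst Fubini') (simp_all add: disk_kernel_sq_commute)
  have "2 * a = (\<integral>\<^sup>+z. \<integral>\<^sup>+w. ennreal ((f z)\<^sup>2 * disk_kernel_sq L z w) + ennreal ((f w)\<^sup>2 * disk_kernel_sq L z w) \<partial>?\<mu> \<partial>?\<mu>)"
    unfolding mult_2 by (subst (1) a1, subst a2)
      (subst nn_integral_add[symmetric], measurable, intro nn_integral_cong, subst nn_integral_add, auto)
  also have "\<dots> = (\<integral>\<^sup>+z. \<integral>\<^sup>+w. ennreal ((f z - f w)\<^sup>2 * disk_kernel_sq L z w) +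
      2 * ennreal (f z * f w * disk_kernel_sq L z w) \<partial>?\<mu> \<partial>?\<mu>)"
    using f01(1)
    by (intro nn_integral_cong)
      (subst ennreal_numeral[symmetric], simp only: ennreal_mult[symmetric] zero_le_numeral ennreal_plus[symmetric]
        mult_nonneg_nonneg zero_le_power2 disk_kernel_sq_nonneg,
       simp add: power2_eq_square algebra_simps)
  also have "\<dots> = e + 2 * b"
    unfolding e_def b_def
    by (subst nn_integral_cmult[symmetric], measurable, subst nn_integral_add[symmetric], measurable)
      (intro nn_integral_cong, subst nn_integral_add, auto simp: nn_integral_cmult)
  finally have "2 * a = e + 2 * b" .
  moreover have "2 * a = 2 * ennreal V + 2 * b"
    unfolding Vab(1)[symmetric] by (simp add: distrib_left)
  ultimately have "2 * ennreal V + 2 * b = e + 2 * b" by simp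
  then have "2 * ennreal V = e"
    using Vab(2) by (simp only: add.commute[of _ "2 * b"] ennreal_add_left_cancel)
      (auto simp: ennreal_mult_eq_top_iff)
  then show ?thesis unfolding V_def e_def .
qed

section \<open>Bounds for the test functions\<close>

text \<open>The integral of \<open>s powr (p - 2)\<close> over the interval from \<open>a > 0\<close> to \<open>b\<close>.\<close>
definition powr_integral :: "real \<Rightarrow> real \<Rightarrow> real \<Rightarrow> real" where
  "powr_integral p a b = (if p = 1 then ln b - ln a else (b powr (p - 1) - a powr (p - 1)) / (p - 1))"

lemma powr_integral_nonneg:
  assumes "0 < a" "a \<le> b"
  shows "0 \<le> powr_integral p a b"
proof -
  consider "p < 1" | "p = 1" | "1 < p" by linarith
  then show ?thesis
  proof cases
    case 1
    then have "b powr (p - 1) \<le> a powr (p - 1)"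
      using assms by (intro powr_mono2') auto
    with 1 show ?thesis by (simp add: powr_integral_def divide_nonpos_neg)
  next
    case 2
    with assms show ?thesis by (simp add: powr_integral_def)
  next
    case 3
    then have "a powr (p - 1) \<le> b powr (p - 1)"
      using assms by (intro powr_mono2) auto
    with 3 show ?thesis by (simp add: powr_integral_def)
  qed
qed

lemma nn_integral_powr_interval:
  assumes "0 < a" "a \<le> b"
  shows "(\<integral>\<^sup>+s\<in>{a..b}. ennreal (s powr (p - 2)) \<partial>lborel) = ennreal (powr_integral p a b)"
proof (rule nn_integral_has_integral_lebesgue')
  show "((\<lambda>s. s powr (p - 2)) has_integral powr_integral p a b) {a..b}"
  proof (cases "p = 1")
    case True
    have "((\<lambda>s. s powr (p - 2)) has_integral (ln b - ln a)) {a..b}"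
      using assms True
      by (intro fundamental_theorem_of_calculus)
        (auto intro!: derivative_eq_intros simp: powr_minus_divide divide_inverse
          simp flip: has_real_derivative_iff_has_vector_derivative)
    then show ?thesis by (simp add: powr_integral_def True)
  next
    case False
    have "((\<lambda>s. s powr (p - 2)) has_integral (b powr (p - 1) / (p - 1) - a powr (p - 1) / (p - 1))) {a..b}"
      using assms False
      by (intro fundamental_theorem_of_calculus)
        (auto intro!: derivative_eq_intros
          simp flip: has_real_derivative_iff_has_vector_derivative)
    then show ?thesis by (simp add: powr_integral_def False diff_divide_distrib)
  qed
qed simp

lemma borel_measurable_test_fun [measurable]: "test_fun p r \<in> borel_measurable borel"
  unfolding test_fun_def[abs_def] by measurable

lemma test_fun_nonneg: "0 \<le> test_fun p r z"
  by (simp add: test_fun_def)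

lemma test_fun_le_1:
  assumes "0 < p" shows "test_fun p r z \<le> 1"
  unfolding test_fun_def using assms by (intro powr_le1) auto

lemma test_fun_outside:
  assumes "0 < r" "r < cmod z" shows "test_fun p r z = 0"
proof -
  have "r\<^sup>2 < (cmod z)\<^sup>2"
    using assms by (intro power_strict_mono) auto
  then have "max (1 - (cmod z)\<^sup>2 / r\<^sup>2) 0 = 0"
    using assms by (simp add: field_simps)
  then show ?thesis by (simp add: test_fun_def)
qed

text \<open>The test function in terms of \<open>1 - |z|\<^sup>2\<close>.\<close>
lemma test_fun_eq:
  assumes "0 < r"
  shows "test_fun p r z = max ((1 - (cmod z)\<^sup>2 - (1 - r\<^sup>2)) / r\<^sup>2) 0 powr (p / 2)"
  using assms by (simp add: test_fun_def diff_divide_distrib)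

lemma variance_upper_bound:
  assumes L: "0 < L" and p: "0 < p" and dpp: "hyperbolic_dpp L M X" and r: "0 < r" "r < 1"
  shows "prob_space.variance M (linear_statistic X (test_fun p r)) \<le> L * powr_integral p (1 - r\<^sup>2) 1"
proof -
  let ?V = "prob_space.variance M (linear_statistic X (test_fun p r))"
  define d where "d = 1 - r\<^sup>2"
  have d: "0 < d" "d < 1" using r by (auto simp: d_def power_less_one_iff)
  define g where "g s = (max ((s - d) / r\<^sup>2) 0 powr (p / 2))\<^sup>2 * s powr (- (L + 1))" for s
  have [measurable]: "g \<in> borel_measurable borel" unfolding g_def[abs_def] by measurable
  have g_le: "L * s powr (L - 1) * g s \<le> L * s powr (p - 2)" if "d < s" "s \<le> 1" for s
  proof -
    have "s * d \<le> 1 * d" using that d by (intro mult_right_mono) auto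
    then have "(s - d) / r\<^sup>2 \<le> s"
      using r by (simp add: divide_le_eq d_def algebra_simps)
    then have "(max ((s - d) / r\<^sup>2) 0 powr (p / 2))\<^sup>2 \<le> (s powr (p / 2))\<^sup>2"
      using that d p by (intro power_mono powr_mono2) auto
    also have "\<dots> = s powr p"
      by (simp add: power2_eq_square powr_add[symmetric])
    finally have "L * s powr (L - 1) * g s \<le> L * s powr (L - 1) * (s powr p * s powr (- (L + 1)))"
      unfolding g_def using L by (intro mult_left_mono mult_right_mono) auto
    also have "\<dots> = L * s powr (p - 2)"
      by (simp add: powr_add[symmetric] mult.assoc)
    finally show ?thesis .
  qed
  have g_0: "g s = 0" if "s \<le> d" for s
  proof -
    have "max ((s - d) / r\<^sup>2) 0 = 0" using that by (simp add: divide_nonpos_nonneg)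
    then show ?thesis by (simp add: g_def)
  qed
  have "ennreal ?V \<le> (\<integral>\<^sup>+z. ennreal ((test_fun p r z)\<^sup>2 * disk_intensity L z) \<partial>disk_measure L)"
    by (rule variance_linear_statistic_le[OF L dpp r])
      (auto simp: test_fun_nonneg test_fun_le_1 p test_fun_outside r)
  also have "\<dots> = (\<integral>\<^sup>+z. ennreal (g (1 - (cmod z)\<^sup>2)) \<partial>disk_measure L)"
    using r by (simp add: test_fun_eq disk_intensity_def g_def d_def)
  also have "\<dots> = (\<integral>\<^sup>+s\<in>{0<..1}. (ennreal (L * s powr (L - 1)) * ennreal (g s)) \<partial>lborel)"
    using nn_integral_disk_measure_radial[of "\<lambda>s. ennreal (g s)" L] L by simp
  also have "\<dots> \<le> (\<integral>\<^sup>+s. ennreal L * (ennreal (s powr (p - 2)) * indicator {d..1} s) \<partial>lborel)"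
  proof (intro nn_integral_mono)
    fix s :: real
    show "ennreal (L * s powr (L - 1)) * ennreal (g s) * indicator {0<..1} s \<le>
        ennreal L * (ennreal (s powr (p - 2)) * indicator {d..1} s)"
    proof (cases "d < s \<and> s \<le> 1")
      case True
      then show ?thesis
        using d L g_le[of s] by (simp add: ennreal_mult'[symmetric] ennreal_leI)
    next
      case False
      then show ?thesis using g_0[of s] by (auto simp: indicator_def)
    qed
  qed
  also have "\<dots> = ennreal L * ennreal (powr_integral p d 1)"
    using d by (subst nn_integral_cmult) (auto simp: nn_integral_powr_interval)
  also have "\<dots> = ennreal (L * powr_integral p d 1)"
    using L by (simp add: ennreal_mult')
  finally have "ennreal ?V \<le> ennreal (L * powr_integral p d 1)" .
  moreover have "0 \<le> powr_integral p d 1"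
    using d by (intro powr_integral_nonneg) auto
  ultimately show ?thesis
    using L by (simp add: ennreal_le_iff d_def)
qed

text \<open>
  Put \<open>s = 1 - |z|\<^sup>2\<close>. On the disk \<open>B\<close> of radius \<open>s/2\<close> about \<open>(1 - 2 s) z\<close>, the quantity \<open>1 - |w|\<^sup>2\<close> lies
  between \<open>5/4 s\<close> and \<open>6 s\<close>, while \<open>|1 - z * cnj w| \<le> 4 s\<close>. Since \<open>f\<close> is a power of a multiple of
  \<open>1 - |w|\<^sup>2 - (1 - r\<^sup>2)\<close>, it is larger on \<open>B\<close> than at \<open>z\<close> by the fixed factor
  \<open>(5/4) powr (p/2)\<close> at least. The constant \<open>\<kappa>\<close> covers both signs of \<open>L - 1\<close> in the density.
\<close>
lemma local_dirichlet_lower_bound: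
  assumes L: "0 < L" and p: "0 < p"
  obtains c where "0 < c" and
    "\<And>r z. 0 < r \<Longrightarrow> r < 1 \<Longrightarrow> 2 * (1 - r\<^sup>2) \<le> 1 - (cmod z)\<^sup>2 \<Longrightarrow> 1 - (cmod z)\<^sup>2 \<le> 1 / 4 \<Longrightarrow>
      ennreal (c * (1 - (cmod z)\<^sup>2) powr (p - L - 1)) \<le>
      (\<integral>\<^sup>+w. ennreal ((test_fun p r z - test_fun p r w)\<^sup>2 * disk_kernel_sq L z w) \<partial>disk_measure L)"
proof -
  define \<kappa> where "\<kappa> = min 1 (6 powr (L - 1))"
  define \<gamma> where "\<gamma> = (5 / 4) powr (p / 2) - (1::real)"
  define c where "c = L / pi * \<kappa> * (\<gamma>\<^sup>2 * 2 powr (- p)) * 4 powr (- 2 * (L + 1)) * (pi / 4)"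
  have \<kappa>: "0 < \<kappa>" by (simp add: \<kappa>_def)
  have "(1::real) powr (p / 2) < (5 / 4) powr (p / 2)"
    using p by (intro powr_less_mono2) auto
  then have \<gamma>: "0 < \<gamma>" by (simp add: \<gamma>_def)
  show thesis
  proof (rule that)
    show "0 < c" using L \<kappa> \<gamma> by (simp add: c_def)
  next
    fix r :: real and z :: complex
    assume r: "0 < r" "r < 1" and s1: "2 * (1 - r\<^sup>2) \<le> 1 - (cmod z)\<^sup>2" and s2: "1 - (cmod z)\<^sup>2 \<le> 1 / 4"
    define s where "s = 1 - (cmod z)\<^sup>2"
    define d where "d = 1 - r\<^sup>2"
    have d: "0 < d" using r by (simp add: d_def power_less_one_iff)
    have s: "2 * d \<le> s" "s \<le> 1 / 4" "0 < s"
      using s1 s2 d by (auto simp: s_def d_def)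
    have z2: "3 / 4 \<le> (cmod z)\<^sup>2" "(cmod z)\<^sup>2 < 1"
      using s by (auto simp: s_def)
    have z: "1 / 2 \<le> cmod z" "cmod z < 1"
      using z2 power2_le_imp_le[of "1 / 2" "cmod z"] abs_square_less_1[of "cmod z"]
      by (auto simp: power2_eq_square)
    define B where "B = ball (z * of_real (1 - 2 * s)) (s / 2)"
    have cmod_c: "cmod (z * of_real (1 - 2 * s)) = cmod z * (1 - 2 * s)"
      unfolding norm_mult norm_of_real using s by simp
    have B1: "cmod w \<le> cmod z - s / 2" if "w \<in> B" for w
    proof -
      have "cmod w \<le> cmod z * (1 - 2 * s) + s / 2"
        using that norm_triangle_ineq2[of w "z * of_real (1 - 2 * s)"] unfolding cmod_c
        by (auto simp: B_def dist_norm norm_minus_commute)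
      also have "\<dots> \<le> cmod z - s / 2"
        using mult_right_mono[OF z(1), of s] s by (simp add: algebra_simps)
      finally show ?thesis .
    qed
    have B2: "cmod (z - w) \<le> 5 / 2 * s" if "w \<in> B" for w
    proof -
      have "cmod (z - w) \<le> cmod (z - z * of_real (1 - 2 * s)) + cmod (z * of_real (1 - 2 * s) - w)"
        using norm_triangle_ineq[of "z - z * of_real (1 - 2 * s)" "z * of_real (1 - 2 * s) - w"] by simp
      also have "z - z * of_real (1 - 2 * s) = z * of_real (2 * s)"
        by (simp add: algebra_simps)
      also have "cmod (z * of_real (2 * s)) = cmod z * (2 * s)"
        unfolding norm_mult norm_of_real using s by simp
      also have "\<dots> \<le> 2 * s" using z s by (simp add: mult_left_le_one_le)
      also have "cmod (z * of_real (1 - 2 * s) - w) \<le> s / 2"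
        using that by (simp add: B_def dist_norm)
      finally show ?thesis by simp
    qed
    have B_lt: "cmod w < 1" if "w \<in> B" for w
      using B1[OF that] z s by linarith
    have w_lower: "5 / 4 * s \<le> 1 - (cmod w)\<^sup>2" and w_upper: "1 - (cmod w)\<^sup>2 \<le> 6 * s" if "w \<in> B" for w
    proof -
      have "(cmod w)\<^sup>2 \<le> (cmod z - s / 2)\<^sup>2"
        using B1[OF that] by (intro power_mono) auto
      also have "\<dots> = (cmod z)\<^sup>2 - s * (cmod z - s / 4)"
        by (simp add: power2_eq_square algebra_simps)
      also have "\<dots> \<le> (cmod z)\<^sup>2 - s * (1 / 4)"
        using z s by (intro diff_left_mono mult_left_mono) auto
      finally show "5 / 4 * s \<le> 1 - (cmod w)\<^sup>2" using s_def by linarith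
      have "(cmod z)\<^sup>2 - (cmod w)\<^sup>2 = (cmod z + cmod w) * (cmod z - cmod w)"
        by (simp add: power2_eq_square algebra_simps)
      also have "\<dots> \<le> 2 * (5 / 2 * s)"
        using z B_lt[OF that] B1[OF that] B2[OF that] norm_triangle_ineq2[of z w] s
        by (intro mult_mono) auto
      finally show "1 - (cmod w)\<^sup>2 \<le> 6 * s" by (simp add: s_def)
    qed
    have density: "L / pi * (\<kappa> * s powr (L - 1)) \<le> L / pi * (1 - (cmod w)\<^sup>2) powr (L - 1)" if "w \<in> B" for w
    proof -
      let ?t = "1 - (cmod w)\<^sup>2"
      have t: "s \<le> ?t" "?t \<le> 6 * s" using w_lower[OF that] w_upper[OF that] s by auto
      have "\<kappa> * s powr (L - 1) \<le> ?t powr (L - 1)"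
      proof (cases "1 \<le> L")
        case True
        then have "\<kappa> * s powr (L - 1) \<le> 1 * s powr (L - 1)"
          by (intro mult_right_mono) (auto simp: \<kappa>_def)
        also have "\<dots> \<le> ?t powr (L - 1)"
          using True t s by (simp add: powr_mono2)
        finally show ?thesis .
      next
        case False
        have "\<kappa> * s powr (L - 1) \<le> 6 powr (L - 1) * s powr (L - 1)"
          by (intro mult_right_mono) (auto simp: \<kappa>_def)
        also have "\<dots> = (6 * s) powr (L - 1)"
          using s by (simp add: powr_mult)
        also have "\<dots> \<le> ?t powr (L - 1)"
          using False t s by (intro powr_mono2') auto
        finally show ?thesis .
      qed
      then show ?thesis using L by (intro mult_left_mono) auto
    qed
    have diff: "\<gamma>\<^sup>2 * 2 powr (- p) * s powr p \<le> (test_fun p r z - test_fun p r w)\<^sup>2" if "w \<in> B" for w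
    proof -
      let ?t = "1 - (cmod w)\<^sup>2"
      have r2: "0 < r\<^sup>2" "r\<^sup>2 \<le> 1" using r by (auto simp: power_le_one)
      have fz: "test_fun p r z = ((s - d) / r\<^sup>2) powr (p / 2)"
      proof -
        have "0 < (s - d) / r\<^sup>2" using s d r2 by (intro divide_pos_pos) auto
        then show ?thesis
          unfolding test_fun_eq[OF r(1)] s_def[symmetric] d_def[symmetric] by (simp add: max_def)
      qed
      have "5 / 4 * ((s - d) / r\<^sup>2) \<le> (?t - d) / r\<^sup>2"
      proof -
        have "5 / 4 * (s - d) \<le> ?t - d" using w_lower[OF that] d by (simp add: right_diff_distrib)
        then have "5 / 4 * (s - d) / r\<^sup>2 \<le> (?t - d) / r\<^sup>2"
          using r2 by (intro divide_right_mono) auto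
        then show ?thesis by simp
      qed
      then have "(5 / 4 * ((s - d) / r\<^sup>2)) powr (p / 2) \<le> test_fun p r w"
        unfolding test_fun_eq[OF r(1)] d_def[symmetric] using s d p r2
        by (intro powr_mono2) auto
      moreover have "(5 / 4 * ((s - d) / r\<^sup>2)) powr (p / 2) = (5 / 4) powr (p / 2) * test_fun p r z"
        unfolding fz by (rule powr_mult)
      ultimately have 1: "\<gamma> * test_fun p r z \<le> test_fun p r w - test_fun p r z"
        by (simp add: \<gamma>_def left_diff_distrib)
      have "s / 2 \<le> (s - d) / r\<^sup>2"
      proof -
        have "s / 2 \<le> (s - d) / 1" using s by simp
        also have "\<dots> \<le> (s - d) / r\<^sup>2" using s d r2 by (intro divide_left_mono) auto
        finally show ?thesis .
      qed
      then have "(s / 2) powr (p / 2) \<le> test_fun p r z"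
        unfolding fz using s p by (intro powr_mono2) auto
      then have "\<gamma> * (s / 2) powr (p / 2) \<le> test_fun p r w - test_fun p r z"
        using 1 \<gamma> mult_left_mono[of "(s / 2) powr (p / 2)" "test_fun p r z" \<gamma>] by linarith
      then have "(\<gamma> * (s / 2) powr (p / 2))\<^sup>2 \<le> (test_fun p r w - test_fun p r z)\<^sup>2"
        using \<gamma> by (intro power_mono) auto
      also have "(\<gamma> * (s / 2) powr (p / 2))\<^sup>2 = \<gamma>\<^sup>2 * 2 powr (- p) * s powr p"
        using s by (simp add: power_mult_distrib power2_eq_square powr_add[symmetric] powr_divide powr_minus_divide)
      finally show ?thesis by (simp add: power2_commute)
    qed
    have kernel: "4 powr (- 2 * (L + 1)) * s powr (- 2 * (L + 1)) \<le> disk_kernel_sq L z w" if "w \<in> B" for w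
    proof -
      have nz: "1 - z * cnj w \<noteq> 0"
        using one_minus_mult_cnj_nz[OF B_lt[OF that] z(2)] by (simp add: mult.commute)
      have "1 - z * cnj w = of_real s + z * cnj (z - w)"
        unfolding s_def using complex_norm_square[of z] by (simp add: algebra_simps)
      then have "cmod (1 - z * cnj w) \<le> cmod (of_real s) + cmod (z * cnj (z - w))"
        by (metis norm_triangle_ineq)
      also have "cmod (z * cnj (z - w)) = cmod z * cmod (z - w)"
        unfolding norm_mult complex_mod_cnj ..
      also have "\<dots> \<le> 1 * (5 / 2 * s)"
        using z B2[OF that] by (intro mult_mono) auto
      finally have "cmod (1 - z * cnj w) \<le> 4 * s" using s by simp
      then have "(4 * s) powr (- 2 * (L + 1)) \<le> disk_kernel_sq L z w"
        unfolding disk_kernel_sq_def using nz L by (intro powr_mono2') auto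
      then show ?thesis using s by (simp add: powr_mult)
    qed
    define K where "K = (L / pi * (\<kappa> * s powr (L - 1))) *
      ((\<gamma>\<^sup>2 * 2 powr (- p) * s powr p) * (4 powr (- 2 * (L + 1)) * s powr (- 2 * (L + 1))))"
    have K: "0 \<le> K" unfolding K_def using L \<kappa> by auto
    have "s powr (L - 1) * s powr p * s powr (- 2 * (L + 1)) * s\<^sup>2 = s powr (p - L - 1)"
      using s by (simp add: powr_add[symmetric] flip: powr_numeral)
    then have "c * s powr (p - L - 1) =
        c * (s powr (L - 1) * s powr p * s powr (- 2 * (L + 1)) * s\<^sup>2)" by simp
    also have "\<dots> = K * (pi * (s / 2)\<^sup>2)"
      by (simp add: c_def K_def power2_eq_square)
    finally have cK: "c * s powr (p - L - 1) = K * (pi * (s / 2)\<^sup>2)" .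
    have "ennreal (c * s powr (p - L - 1)) = ennreal K * emeasure lborel B"
      unfolding cK B_def using s K
      by (subst emeasure_ball) (auto simp: ennreal_mult eval_unit_ball_vol)
    also have "\<dots> = (\<integral>\<^sup>+w. ennreal K * indicator B w \<partial>lborel)"
      by (subst nn_integral_cmult_indicator) (auto simp: B_def)
    also have "\<dots> \<le> (\<integral>\<^sup>+w\<in>unit_disk. (ennreal (L / pi * (1 - (cmod w)\<^sup>2) powr (L - 1)) *
       ennreal ((test_fun p r z - test_fun p r w)\<^sup>2 * disk_kernel_sq L z w)) \<partial>lborel)"
    proof (intro nn_integral_mono)
      fix w
      show "ennreal K * indicator B w \<le> ennreal (L / pi * (1 - (cmod w)\<^sup>2) powr (L - 1)) *
       ennreal ((test_fun p r z - test_fun p r w)\<^sup>2 * disk_kernel_sq L z w) * indicator unit_disk w"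
      proof (cases "w \<in> B")
        case True
        have "K \<le> (L / pi * (1 - (cmod w)\<^sup>2) powr (L - 1)) * ((test_fun p r z - test_fun p r w)\<^sup>2 * disk_kernel_sq L z w)"
          unfolding K_def using L
          by (intro mult_mono[OF density[OF True] mult_mono[OF diff[OF True] kernel[OF True]]]) auto
        then show ?thesis
          using True B_lt[OF True] L by (simp add: ennreal_mult'[symmetric] ennreal_leI)
      qed simp
    qed
    also have "\<dots> = (\<integral>\<^sup>+w. ennreal ((test_fun p r z - test_fun p r w)\<^sup>2 * disk_kernel_sq L z w) \<partial>disk_measure L)"
      by (rule nn_integral_disk_measure[symmetric]) measurable
    finally show "ennreal (c * (1 - (cmod z)\<^sup>2) powr (p - L - 1)) \<le>
       (\<integral>\<^sup>+w. ennreal ((test_fun p r z - test_fun p r w)\<^sup>2 * disk_kernel_sq L z w) \<partial>disk_measure L)"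
      unfolding s_def .
  qed
qed

lemma variance_lower_bound:
  assumes L: "0 < L" and p: "0 < p" and dpp: "hyperbolic_dpp L M X"
  obtains c where "0 < c" and
    "\<And>r. 0 < r \<Longrightarrow> r < 1 \<Longrightarrow> 2 * (1 - r\<^sup>2) \<le> 1 / 4 \<Longrightarrow>
      c * powr_integral p (2 * (1 - r\<^sup>2)) (1 / 4) \<le> prob_space.variance M (linear_statistic X (test_fun p r))"
proof -
  obtain c where c: "0 < c" and c_le:
    "\<And>r z. 0 < r \<Longrightarrow> r < 1 \<Longrightarrow> 2 * (1 - r\<^sup>2) \<le> 1 - (cmod z)\<^sup>2 \<Longrightarrow> 1 - (cmod z)\<^sup>2 \<le> 1 / 4 \<Longrightarrow>
      ennreal (c * (1 - (cmod z)\<^sup>2) powr (p - L - 1)) \<le>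
      (\<integral>\<^sup>+w. ennreal ((test_fun p r z - test_fun p r w)\<^sup>2 * disk_kernel_sq L z w) \<partial>disk_measure L)"
    using local_dirichlet_lower_bound[OF L p] by blast
  show thesis
  proof (rule that)
    show "0 < L * c / 2" using L c by simp
  next
    fix r :: real assume r: "0 < r" "r < 1" and d4: "2 * (1 - r\<^sup>2) \<le> 1 / 4"
    define d where "d = 2 * (1 - r\<^sup>2)"
    have d: "0 < d" "d \<le> 1 / 4" using r d4 by (auto simp: d_def power_less_one_iff)
    let ?V = "prob_space.variance M (linear_statistic X (test_fun p r))"
    have V0: "0 \<le> ?V"
      by (intro integral_nonneg_AE) auto
    have "ennreal (L * c * powr_integral p d (1 / 4)) = ennreal (L * c) * (\<integral>\<^sup>+s\<in>{d..1/4}. ennreal (s powr (p - 2)) \<partial>lborel)"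
      using d L c by (simp add: nn_integral_powr_interval ennreal_mult')
    also have "\<dots> = (\<integral>\<^sup>+s. ennreal (L * c) * (ennreal (s powr (p - 2)) * indicator {d..1/4} s) \<partial>lborel)"
      by (subst nn_integral_cmult) auto
    also have "\<dots> = (\<integral>\<^sup>+s\<in>{0<..1}. (ennreal (L * s powr (L - 1)) * (ennreal (c * s powr (p - L - 1)) * indicator {d..1/4} s)) \<partial>lborel)"
    proof (intro nn_integral_cong)
      fix s :: real
      show "ennreal (L * c) * (ennreal (s powr (p - 2)) * indicator {d..1/4} s) =
        ennreal (L * s powr (L - 1)) * (ennreal (c * s powr (p - L - 1)) * indicator {d..1/4} s) * indicator {0<..1} s"
      proof (cases "s \<in> {d..1/4}")
        case True
        have "L * s powr (L - 1) * (c * s powr (p - L - 1)) = L * c * (s powr (L - 1) * s powr (p - L - 1))"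
          by simp
        also have "\<dots> = L * c * s powr (p - 2)"
          by (simp add: powr_add[symmetric])
        finally show ?thesis
          using True d L c by (simp add: ennreal_mult'[symmetric])
      qed simp
    qed
    also have "\<dots> = (\<integral>\<^sup>+z. ennreal (c * (1 - (cmod z)\<^sup>2) powr (p - L - 1)) * indicator {d..1/4} (1 - (cmod z)\<^sup>2) \<partial>disk_measure L)"
      using L by (subst nn_integral_disk_measure_radial[symmetric]) auto
    also have "\<dots> \<le> (\<integral>\<^sup>+z. \<integral>\<^sup>+w. ennreal ((test_fun p r z - test_fun p r w)\<^sup>2 * disk_kernel_sq L z w) \<partial>disk_measure L \<partial>disk_measure L)"
      using c_le[OF r] by (intro nn_integral_mono) (auto simp: d_def indicator_def)
    also have "\<dots> = 2 * ennreal ?V"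
      by (rule variance_linear_statistic_dirichlet[OF L dpp r, symmetric])
        (auto simp: test_fun_nonneg test_fun_le_1 p test_fun_outside r)
    also have "\<dots> = ennreal (2 * ?V)"
      using V0 by (simp add: ennreal_mult')
    finally have "L * c * powr_integral p d (1 / 4) \<le> 2 * ?V"
      using V0 by (subst (asm) ennreal_le_iff) auto
    then show "L * c / 2 * powr_integral p (2 * (1 - r\<^sup>2)) (1 / 4) \<le> ?V"
      by (simp add: d_def)
  qed
qed

lemma powr_integral_asymptotics:
  shows "p < 1 \<Longrightarrow> (\<lambda>r. powr_integral p (1 - r\<^sup>2) 1) \<in> \<Theta>[at_left 1](\<lambda>r. (1 - r) powr (- (1 - p)))"
    and "p < 1 \<Longrightarrow> (\<lambda>r. powr_integral p (2 * (1 - r\<^sup>2)) (1 / 4)) \<in> \<Theta>[at_left 1](\<lambda>r. (1 - r) powr (- (1 - p)))"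
    and "p = 1 \<Longrightarrow> (\<lambda>r. powr_integral p (1 - r\<^sup>2) 1) \<in> \<Theta>[at_left 1](\<lambda>r. - ln (1 - r))"
    and "p = 1 \<Longrightarrow> (\<lambda>r. powr_integral p (2 * (1 - r\<^sup>2)) (1 / 4)) \<in> \<Theta>[at_left 1](\<lambda>r. - ln (1 - r))"
    and "p > 1 \<Longrightarrow> (\<lambda>r. powr_integral p (1 - r\<^sup>2) 1) \<in> \<Theta>[at_left 1](\<lambda>r. 1)"
    and "p > 1 \<Longrightarrow> (\<lambda>r. powr_integral p (2 * (1 - r\<^sup>2)) (1 / 4)) \<in> \<Theta>[at_left 1](\<lambda>r. 1)"
  unfolding powr_integral_def by (simp only: if_True if_False less_imp_neq less_imp_neq[THEN not_sym] refl, real_asymp)+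

theorem theorem6p4:
  fixes L p :: real and M :: "'a measure" and X :: "'a \<Rightarrow> complex set"
  assumes "0 < L" and "0 < p" and "hyperbolic_dpp L M X"
  shows "(p < 1 \<longrightarrow>
            (\<lambda>r. prob_space.variance M (linear_statistic X (test_fun p r)))
              \<in> \<Theta>[at_left 1](\<lambda>r. (1 - r) powr (- (1 - p)))) \<and>
         (p = 1 \<longrightarrow>
            (\<lambda>r. prob_space.variance M (linear_statistic X (test_fun p r)))
              \<in> \<Theta>[at_left 1](\<lambda>r. - ln (1 - r))) \<and>
         (p > 1 \<longrightarrow>
            (\<lambda>r. prob_space.variance M (linear_statistic X (test_fun p r)))
              \<in> \<Theta>[at_left 1](\<lambda>r. 1))"
proof -
  let ?V = "\<lambda>r. prob_space.variance M (linear_statistic X (test_fun p r))"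
  obtain c where c: "0 < c" and lower: "\<And>r. 0 < r \<Longrightarrow> r < 1 \<Longrightarrow> 2 * (1 - r\<^sup>2) \<le> 1 / 4 \<Longrightarrow>
      c * powr_integral p (2 * (1 - r\<^sup>2)) (1 / 4) \<le> ?V r"
    using variance_lower_bound[OF assms] by blast
  have ev: "eventually (\<lambda>r. 0 < r \<and> r < 1 \<and> 2 * (1 - r\<^sup>2) \<le> 1 / 4) (at_left (1::real))"
    by (intro eventually_conj; real_asymp)
  have V0: "0 \<le> ?V r" for r
    by (intro integral_nonneg_AE) auto
  have I0: "0 \<le> powr_integral p (2 * (1 - r\<^sup>2)) (1 / 4)" if "r < 1" "2 * (1 - r\<^sup>2) \<le> 1 / 4" "0 < r" for r
    using that by (intro powr_integral_nonneg) (auto simp: power_less_one_iff)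
  have upper: "?V \<in> O[at_left 1](\<lambda>r. powr_integral p (1 - r\<^sup>2) 1)"
  proof (rule bigoI[of _ L])
    show "\<forall>\<^sub>F r in at_left 1. norm (?V r) \<le> L * norm (powr_integral p (1 - r\<^sup>2) 1)"
      using ev
    proof eventually_elim
      case (elim r)
      then have "?V r \<le> L * powr_integral p (1 - r\<^sup>2) 1"
        using variance_upper_bound[OF assms, of r] by simp
      also have "\<dots> \<le> L * norm (powr_integral p (1 - r\<^sup>2) 1)"
        using assms(1) by (intro mult_left_mono) auto
      finally show ?case using V0[of r] by simp
    qed
  qed
  have lower': "(\<lambda>r. powr_integral p (2 * (1 - r\<^sup>2)) (1 / 4)) \<in> O[at_left 1](?V)"
  proof (rule bigoI[of _ "1 / c"])
    show "\<forall>\<^sub>F r in at_left 1. norm (powr_integral p (2 * (1 - r\<^sup>2)) (1 / 4)) \<le> 1 / c * norm (?V r)"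
      using ev
    proof eventually_elim
      case (elim r)
      then show ?case
        using lower[of r] I0[of r] V0[of r] c by (simp add: field_simps)
    qed
  qed
  have sandwich: "?V \<in> \<Theta>[at_left 1](h)"
    if "(\<lambda>r. powr_integral p (1 - r\<^sup>2) 1) \<in> \<Theta>[at_left 1](h)"
      "(\<lambda>r. powr_integral p (2 * (1 - r\<^sup>2)) (1 / 4)) \<in> \<Theta>[at_left 1](h)" for h
  proof (rule bigthetaI)
    show "?V \<in> O[at_left 1](h)"
      using upper that(1) by (rule landau_o.big.bigtheta_trans1)
    have "h \<in> O[at_left 1](\<lambda>r. powr_integral p (2 * (1 - r\<^sup>2)) (1 / 4))"
      using that(2) by (simp add: bigtheta_def bigomega_iff_bigo)
    then have "h \<in> O[at_left 1](?V)"
      using lower' by (rule landau_o.big_trans)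
    then show "?V \<in> \<Omega>[at_left 1](h)"
      by (simp add: bigomega_iff_bigo)
  qed
  show ?thesis
    by (intro conjI impI sandwich powr_integral_asymptotics)
qed

end
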